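(* Let $R$ be an integral domain such that $R/(m)$ is finite for every $m\in R\setminus\{0\}$, and let $K$ be its field of fractions. Let $\Psi:\mathfrak{A}[R]\to C^*_{\mathrm{p}}(K\rtimes K^\times,\mathcal{R})$ be the $*$-isomorphism with $\Psi(u^n)=[n,1]$ and $\Psi(s_m)=[0,m]$, let $E$ be the conditional expectation on $C^*_{\mathrm{p}}(K\rtimes K^\times,\mathcal{R})$ and $\Theta$ the conditional expectation on $\mathfrak{A}[R]$ described in the context. Then $E\circ\Psi=\Psi\circ\Theta$.
   Context: An integral domain is a unital commutative ring without zero divisors. $R^\times=R\setminus\{0\}$, $K^\times=K\setminus\{0\}$. The algebra $\mathfrak{A}[R]$ is the universal $C^*$-algebra generated by isometries $\{s_m : m\in R^\times\}$ and unitaries $\{u^n : n\in R\}$ subject to: (CL1) $s_ms_{m'}=s_{mm'}$; (CL2) $u^nu^{n'}=u^{n+n'}$; (CL3) $s_mu^n=u^{mn}s_m$; (CL4) $\sum_{l+(m)\in R/(m)}u^ls_ms_m^*u^{-l}=1$, for all $m,m'\in R^\times$, $n,n'\in R$. (The summands in (CL4) do not depend on the choice of representative $l$.) The group $K\rtimes K^\times$ consists of pairs $(u,w)$, $u\in K$, $w\in K^\times$, with $(u,w)(u',w')=(u+u'w,ww')$, $(u,w)^{-1}=(-u/w,1/w)$ and identity $(0,1)$. For a discrete group $G$, take a formal symbol $[g]$ for each $g\in G$ (for $g=(u,w)$ write $[u,w]$) and put $e_g=[g][g^{-1}]$. Let $\mathcal{R}_{\mathrm{p}}$ be the relations $[e]=1$,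 $[g^{-1}]=[g]^*$, $[g][h][h^{-1}]=[gh][h^{-1}]$ for all $g,h\in G$. For a set $\mathcal{R}$ of relations of the form $\sum_i\lambda_i\prod_j e_{g_{ij}}=0$, $C^*_{\mathrm{p}}(G,\mathcal{R})$ is the universal unital $C^*$-algebra generated by $\{[g]:g\in G\}$ subject to $\mathcal{R}_{\mathrm{p}}\cup\mathcal{R}$. Here $G=K\rtimes K^\times$ and $\mathcal{R}=\mathcal{R}_1\cup\mathcal{R}_2\cup\mathcal{R}_3$, where $\mathcal{R}_1=\{e_{(n,1)}=1 : n\in R\}$, $\mathcal{R}_2=\{e_{(0,1/m)}=1 : m\in R^\times\}$, $\mathcal{R}_3=\{\sum_{n+(m)\in R/(m)}e_{(n,m)}=1 : m\in R^\times\}$ (modulo $\mathcal{R}_1$ and $\mathcal{R}_{\mathrm{p}}$, $e_{(n,m)}$ depends only on the class $n+(m)$). $E:C^*_{\mathrm{p}}(K\rtimes K^\times,\mathcal{R})\to C^*(\{e_g\}_{g\in K\rtimes K^\times})$ is the faithful conditional expectation (coming from the realization of the partial group algebra as a partial crossed product by the amenable group $K\rtimes K^\times$) given by $E([g_1][g_2]\cdots[g_k])=\delta_{g_1g_2\cdots g_k,e}\,[g_1][g_2]\cdots[g_k]$. $\Theta$ is the faithful conditional expectation on $\mathfrak{A}[R]$ constructed by Cuntz and Li, given by $\Theta(s_{m''}^*u^ns_ms_m^*u^{-n'}s_{m'})=\delta_{m',m''}\delta_{n,n'}\,s_{m'}^*u^ns_ms_m^*u^{-n}s_{m'}$ for $m,m',m''\in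 R^\times$, $n,n'\in R$. (The linear span of the elements $s_{m''}^*u^ns_ms_m^*u^{-n'}s_{m'}$ is dense in $\mathfrak{A}[R]$.) *)

theory Defs
  imports
    "HOL-Analysis.Abstract_Metric_Spaces"
    "HOL-Computational_Algebra.Polynomial_Factorial"
    "HOL-Algebra.Module"
begin

section \<open>Unital C*-algebras\<close>

definition complex_ring :: "complex ring" where
  "complex_ring = \<lparr>carrier = UNIV, monoid.mult = (*), one = 1, zero = 0, add = (+)\<rparr>"

record 'a cstar = "(complex, 'a) module" +
  star :: "'a \<Rightarrow> 'a"
  cnorm :: "'a \<Rightarrow> real"

text \<open>The value off the carrier only serves the unrelativised axioms of
  \<^locale>\<open>Metric_space\<close>.\<close>

definition cdist :: "'a cstar \<Rightarrow> 'a \<Rightarrow> 'a \<Rightarrow> real" where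
  "cdist A x y =
     (if x \<in> carrier A \<and> y \<in> carrier A then cnorm A (x \<ominus>\<^bsub>A\<^esub> y) else 0)"

text \<open>The zero algebra is allowed.\<close>

locale cstar_algebra = Module.module complex_ring A + ring A for A :: "'a cstar" (structure) +
  assumes smult_mult_left:
      "\<lbrakk>x \<in> carrier A; y \<in> carrier A\<rbrakk> \<Longrightarrow> (c \<odot> x) \<otimes> y = c \<odot> (x \<otimes> y)"
    and smult_mult_right:
      "\<lbrakk>x \<in> carrier A; y \<in> carrier A\<rbrakk> \<Longrightarrow> x \<otimes> (c \<odot> y) = c \<odot> (x \<otimes> y)"
    and star_closed: "x \<in> carrier A \<Longrightarrow> star A x \<in> carrier A"
    and star_add: "\<lbrakk>x \<in> carrier A; y \<in> carrier A\<rbrakk> \<Longrightarrow> star A (x \<oplus> y) = star A x \<oplus> star A y"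
    and star_smult: "x \<in> carrier A \<Longrightarrow> star A (c \<odot> x) = cnj c \<odot> star A x"
    and star_mult: "\<lbrakk>x \<in> carrier A; y \<in> carrier A\<rbrakk> \<Longrightarrow> star A (x \<otimes> y) = star A y \<otimes> star A x"
    and star_star: "x \<in> carrier A \<Longrightarrow> star A (star A x) = x"
    and cnorm_nonneg: "x \<in> carrier A \<Longrightarrow> 0 \<le> cnorm A x"
    and cnorm_eq_zero_iff: "x \<in> carrier A \<Longrightarrow> cnorm A x = 0 \<longleftrightarrow> x = \<zero>"
    and cnorm_triangle: "\<lbrakk>x \<in> carrier A; y \<in> carrier A\<rbrakk> \<Longrightarrow> cnorm A (x \<oplus> y) \<le> cnorm A x + cnorm A y"
    and cnorm_smult: "x \<in> carrier A \<Longrightarrow> cnorm A (c \<odot> x) = cmod c * cnorm A x"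
    and cnorm_mult: "\<lbrakk>x \<in> carrier A; y \<in> carrier A\<rbrakk> \<Longrightarrow> cnorm A (x \<otimes> y) \<le> cnorm A x * cnorm A y"
    and cstar_identity: "x \<in> carrier A \<Longrightarrow> cnorm A (star A x \<otimes> x) = (cnorm A x)\<^sup>2"
    and complete: "Metric_space.mcomplete (carrier A) (cdist A)"

lemma (in cstar_algebra) Metric_space_cdist: "Metric_space (carrier A) (cdist A)"
proof
  fix x y
  show "0 \<le> cdist A x y" by (simp add: cdist_def cnorm_nonneg)
  { assume xy: "x \<in> carrier A" "y \<in> carrier A"
    have m: "(-1) \<odot> z = \<ominus> z" if "z \<in> carrier A" for z
    proof -
      have "(-1) \<odot> z \<oplus> z = (-1 + 1) \<odot> z"
        using smult_l_distr[of "-1" 1 z] smult_one[of z] that by (simp add: complex_ring_def)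
      then show ?thesis
        using minus_equality[of "(-1) \<odot> z" z] smult_l_null[of z] smult_closed[of "-1" z] that
        by (simp add: complex_ring_def)
    qed
    have "y \<ominus> x = (-1) \<odot> (x \<ominus> y)" using xy m[of "x \<ominus> y"]
        minus_equality[of "y \<ominus> x" "x \<ominus> y"]
      by (simp add: a_minus_def a_assoc r_neg1 r_neg2 l_neg r_neg)
    then have "cnorm A (y \<ominus> x) = cnorm A (x \<ominus> y)" using xy cnorm_smult[of "x \<ominus> y" "-1"] by simp
  }
  then show "cdist A x y = cdist A y x" by (simp add: cdist_def)
next
  fix x y assume "x \<in> carrier A" "y \<in> carrier A"
  then show "(cdist A x y = 0) = (x = y)"
    by (metis cdist_def cnorm_eq_zero_iff minus_closed a_minus_def minus_equality minus_minus
        a_inv_closed r_neg)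
next
  fix x y z assume xyz: "x \<in> carrier A" "y \<in> carrier A" "z \<in> carrier A"
  have "x \<ominus> z = (x \<ominus> y) \<oplus> (y \<ominus> z)" using xyz
    by (simp add: a_minus_def a_assoc r_neg1 r_neg2)
  then show "cdist A x z \<le> cdist A x y + cdist A y z"
    using xyz cnorm_triangle[of "x \<ominus> y" "y \<ominus> z"] by (simp add: cdist_def)
qed

definition cstar_hom :: "'a cstar \<Rightarrow> 'b cstar \<Rightarrow> ('a \<Rightarrow> 'b) set" where
  "cstar_hom A B = {\<phi> \<in> ring_hom A B.
     (\<forall>c. \<forall>x\<in>carrier A. \<phi> (c \<odot>\<^bsub>A\<^esub> x) = c \<odot>\<^bsub>B\<^esub> \<phi> x) \<and>
     (\<forall>x\<in>carrier A. \<phi> (star A x) = star B (\<phi> x))}"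

definition cstar_iso :: "'a cstar \<Rightarrow> 'b cstar \<Rightarrow> ('a \<Rightarrow> 'b) set" where
  "cstar_iso A B = {\<phi> \<in> cstar_hom A B. bij_betw \<phi> (carrier A) (carrier B)}"

definition cstar_subalgebra :: "'a cstar \<Rightarrow> 'a set \<Rightarrow> bool" where
  "cstar_subalgebra A T \<longleftrightarrow> T \<subseteq> carrier A \<and> \<zero>\<^bsub>A\<^esub> \<in> T \<and>
     (\<forall>x\<in>T. \<forall>y\<in>T. x \<oplus>\<^bsub>A\<^esub> y \<in> T \<and> x \<otimes>\<^bsub>A\<^esub> y \<in> T) \<and>
     (\<forall>c. \<forall>x\<in>T. c \<odot>\<^bsub>A\<^esub> x \<in> T) \<and> (\<forall>x\<in>T. star A x \<in> T) \<and>
     closedin (Metric_space.mtopology (carrier A) (cdist A)) T"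

definition cstar_generated :: "'a cstar \<Rightarrow> 'a set \<Rightarrow> 'a set" where
  "cstar_generated A S = \<Inter> {T. cstar_subalgebra A T \<and> S \<subseteq> T}"

definition cstar_positive :: "'a cstar \<Rightarrow> 'a \<Rightarrow> bool" where
  "cstar_positive A x \<longleftrightarrow> (\<exists>y\<in>carrier A. x = star A y \<otimes>\<^bsub>A\<^esub> y)"

definition conditional_expectation :: "'a cstar \<Rightarrow> 'a set \<Rightarrow> ('a \<Rightarrow> 'a) \<Rightarrow> bool" where
  "conditional_expectation A D F \<longleftrightarrow> cstar_subalgebra A D \<and> F \<in> carrier A \<rightarrow> D \<and>
     (\<forall>x\<in>carrier A. \<forall>y\<in>carrier A. F (x \<oplus>\<^bsub>A\<^esub> y) = F x \<oplus>\<^bsub>A\<^esub> F y) \<and>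
     (\<forall>c. \<forall>x\<in>carrier A. F (c \<odot>\<^bsub>A\<^esub> x) = c \<odot>\<^bsub>A\<^esub> F x) \<and>
     (\<forall>d\<in>D. F d = d) \<and>
     (\<forall>d\<in>D. \<forall>x\<in>carrier A. F (d \<otimes>\<^bsub>A\<^esub> x) = d \<otimes>\<^bsub>A\<^esub> F x \<and> F (x \<otimes>\<^bsub>A\<^esub> d) = F x \<otimes>\<^bsub>A\<^esub> d) \<and>
     (\<forall>x. cstar_positive A x \<longrightarrow> cstar_positive A (F x)) \<and>
     (\<forall>x\<in>carrier A. cnorm A (F x) \<le> cnorm A x)"

definition faithful_conditional_expectation :: "'a cstar \<Rightarrow> 'a set \<Rightarrow> ('a \<Rightarrow> 'a) \<Rightarrow> bool" where
  "faithful_conditional_expectation A D F \<longleftrightarrow> conditional_expectation A D F \<and>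
     (\<forall>x\<in>carrier A. F (star A x \<otimes>\<^bsub>A\<^esub> x) = \<zero>\<^bsub>A\<^esub> \<longrightarrow> x = \<zero>\<^bsub>A\<^esub>)"

section \<open>The ring C*-algebra of an integral domain\<close>

definition principal_cosets :: "'r::idom \<Rightarrow> 'r set set" where
  "principal_cosets m = range (\<lambda>l. {l + m * r | r. True})"

text \<open>The function \<open>\<rho>\<close> in (CL4) is an arbitrary choice of representatives
  of the cosets of the ideal generated by \<open>m\<close>. The value \<open>s 0\<close> is irrelevant.\<close>

definition cuntz_li_relations :: "'a cstar \<Rightarrow> ('r::idom \<Rightarrow> 'a) \<Rightarrow> ('r \<Rightarrow> 'a) \<Rightarrow> bool" where
  "cuntz_li_relations A s u \<longleftrightarrow>
     (\<forall>m. m \<noteq> 0 \<longrightarrow> s m \<in> carrier A \<and> star A (s m) \<otimes>\<^bsub>A\<^esub> s m = \<one>\<^bsub>A\<^esub>) \<and>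
     (\<forall>n. u n \<in> carrier A \<and> star A (u n) \<otimes>\<^bsub>A\<^esub> u n = \<one>\<^bsub>A\<^esub> \<and> u n \<otimes>\<^bsub>A\<^esub> star A (u n) = \<one>\<^bsub>A\<^esub>) \<and>
     (\<forall>m m'. m \<noteq> 0 \<longrightarrow> m' \<noteq> 0 \<longrightarrow> s m \<otimes>\<^bsub>A\<^esub> s m' = s (m * m')) \<and>
     (\<forall>n n'. u n \<otimes>\<^bsub>A\<^esub> u n' = u (n + n')) \<and>
     (\<forall>m n. m \<noteq> 0 \<longrightarrow> s m \<otimes>\<^bsub>A\<^esub> u n = u (m * n) \<otimes>\<^bsub>A\<^esub> s m) \<and>
     (\<forall>m \<rho>. m \<noteq> 0 \<longrightarrow> (\<forall>C\<in>principal_cosets m. \<rho> C \<in> C) \<longrightarrow>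
        (\<Oplus>\<^bsub>A\<^esub>C\<in>principal_cosets m.
           u (\<rho> C) \<otimes>\<^bsub>A\<^esub> s m \<otimes>\<^bsub>A\<^esub> star A (s m) \<otimes>\<^bsub>A\<^esub> u (- \<rho> C)) = \<one>\<^bsub>A\<^esub>)"

text \<open>The triple \<open>(A, s, u)\<close> is universal. It suffices to test universality against
  C*-algebras with carrier in the type \<^typ>\<open>nat \<Rightarrow> 'r + nat\<close>: given relations-satisfying
  families in any C*-algebra, the C*-subalgebra they generate has a dense subset
  of cardinality at most that of \<^typ>\<open>'r + nat\<close>, namely the *-polynomials with
  Gaussian rational coefficients, hence it embeds as a set into this type. The homomorphism
  is unique because \<open>A\<close> is generated by the two families.\<close>

definition is_ring_cstar_algebra ::
    "'a cstar \<Rightarrow> ('r::idom \<Rightarrow> 'a) \<Rightarrow> ('r \<Rightarrow> 'a) \<Rightarrow> bool" where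
  "is_ring_cstar_algebra A s u \<longleftrightarrow> cstar_algebra A \<and> cuntz_li_relations A s u \<and>
     cstar_generated A (s ` (UNIV - {0}) \<union> range u) = carrier A \<and>
     (\<forall>(B :: (nat \<Rightarrow> 'r + nat) cstar) t v. cstar_algebra B \<longrightarrow> cuntz_li_relations B t v \<longrightarrow>
        (\<exists>\<phi> \<in> cstar_hom A B. (\<forall>m. m \<noteq> 0 \<longrightarrow> \<phi> (s m) = t m) \<and> (\<forall>n. \<phi> (u n) = v n)))"

section \<open>Partial group C*-algebras with relations\<close>

definition list_prod :: "('a, 'm) monoid_scheme \<Rightarrow> 'a list \<Rightarrow> 'a" where
  "list_prod M xs = foldr (\<otimes>\<^bsub>M\<^esub>) xs \<one>\<^bsub>M\<^esub>"

definition range_proj :: "'g monoid \<Rightarrow> 'a cstar \<Rightarrow> ('g \<Rightarrow> 'a) \<Rightarrow> 'g \<Rightarrow> 'a" where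
  "range_proj G A \<pi> g = \<pi> g \<otimes>\<^bsub>A\<^esub> \<pi> (inv\<^bsub>G\<^esub> g)"

definition partial_relations :: "'g monoid \<Rightarrow> 'a cstar \<Rightarrow> ('g \<Rightarrow> 'a) \<Rightarrow> bool" where
  "partial_relations G A \<pi> \<longleftrightarrow>
     (\<forall>g\<in>carrier G. \<pi> g \<in> carrier A) \<and> \<pi> \<one>\<^bsub>G\<^esub> = \<one>\<^bsub>A\<^esub> \<and>
     (\<forall>g\<in>carrier G. \<pi> (inv\<^bsub>G\<^esub> g) = star A (\<pi> g)) \<and>
     (\<forall>g\<in>carrier G. \<forall>h\<in>carrier G.
        \<pi> g \<otimes>\<^bsub>A\<^esub> \<pi> h \<otimes>\<^bsub>A\<^esub> \<pi> (inv\<^bsub>G\<^esub> h) = \<pi> (g \<otimes>\<^bsub>G\<^esub> h) \<otimes>\<^bsub>A\<^esub> \<pi> (inv\<^bsub>G\<^esub> h))"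

text \<open>A list of pairs \<open>(\<lambda>\<^sub>i, [g\<^sub>i\<^sub>1, g\<^sub>i\<^sub>2, \<dots>])\<close> stands for the relation
  \<open>\<Sum>\<^sub>i \<lambda>\<^sub>i \<Prod>\<^sub>j e (g\<^sub>i\<^sub>j) = 0\<close>; the empty product is the unit.\<close>

type_synonym 'g proj_relation = "(complex \<times> 'g list) list"

definition proj_combination ::
    "'g monoid \<Rightarrow> 'a cstar \<Rightarrow> ('g \<Rightarrow> 'a) \<Rightarrow> 'g proj_relation \<Rightarrow> 'a" where
  "proj_combination G A \<pi> r =
     foldr (\<lambda>(c, gs) y. c \<odot>\<^bsub>A\<^esub> list_prod A (map (range_proj G A \<pi>) gs) \<oplus>\<^bsub>A\<^esub> y) r \<zero>\<^bsub>A\<^esub>"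

definition partial_relations_with ::
    "'g monoid \<Rightarrow> 'g proj_relation set \<Rightarrow> 'a cstar \<Rightarrow> ('g \<Rightarrow> 'a) \<Rightarrow> bool" where
  "partial_relations_with G \<R> A \<pi> \<longleftrightarrow> partial_relations G A \<pi> \<and>
     (\<forall>r\<in>\<R>. proj_combination G A \<pi> r = \<zero>\<^bsub>A\<^esub>)"

text \<open>The type \<^typ>\<open>nat \<Rightarrow> 'g + nat\<close> is large enough for the same reason as above.\<close>

definition is_partial_group_cstar_algebra ::
    "'g monoid \<Rightarrow> 'g proj_relation set \<Rightarrow> 'a cstar \<Rightarrow> ('g \<Rightarrow> 'a) \<Rightarrow> bool" where
  "is_partial_group_cstar_algebra G \<R> A \<pi> \<longleftrightarrow>
     cstar_algebra A \<and> partial_relations_with G \<R> A \<pi> \<and>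
     cstar_generated A (\<pi> ` carrier G) = carrier A \<and>
     (\<forall>(B :: (nat \<Rightarrow> 'g + nat) cstar) \<sigma>. cstar_algebra B \<longrightarrow> partial_relations_with G \<R> B \<sigma> \<longrightarrow>
        (\<exists>\<phi> \<in> cstar_hom A B. \<forall>g\<in>carrier G. \<phi> (\<pi> g) = \<sigma> g))"

section \<open>The relations for the affine group of the field of fractions\<close>

definition affine_group :: "('k::field \<times> 'k) monoid" where
  "affine_group = \<lparr>carrier = UNIV \<times> (UNIV - {0}),
     monoid.mult = (\<lambda>(u, w) (u', w'). (u + u' * w, w * w')), one = (0, 1)\<rparr>"

lemma affine_group_is_group: "group (affine_group :: ('k::field \<times> 'k) monoid)"
proof (rule groupI)
  fix x :: "'k \<times> 'k"
  assume "x \<in> carrier affine_group"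
  then show "\<exists>y\<in>carrier affine_group. y \<otimes>\<^bsub>affine_group\<^esub> x = \<one>\<^bsub>affine_group\<^esub>"
    by (intro bexI [of _ "(- fst x / snd x, 1 / snd x)"])
       (auto simp: affine_group_def field_simps)
qed (auto simp: affine_group_def algebra_simps)

lemma affine_group_inv:
  assumes "w \<noteq> (0 :: 'k::field)"
  shows "inv\<^bsub>affine_group\<^esub> (u, w) = (- u / w, 1 / w)"
proof -
  interpret group "affine_group :: ('k \<times> 'k) monoid"
    by (rule affine_group_is_group)
  show ?thesis
    by (rule inv_equality) (use assms in \<open>auto simp: affine_group_def field_simps\<close>)
qed

definition relations1 :: "('r::idom fract \<times> 'r fract) proj_relation set" where
  "relations1 = {[(1, [(to_fract n, 1)]), (-1, [])] | n. True}"

definition relations2 :: "('r::idom fract \<times> 'r fract) proj_relation set" where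
  "relations2 = {[(1, [(0, 1 / to_fract m)]), (-1, [])] | m. m \<noteq> 0}"

text \<open>Here \<open>Cs\<close> enumerates the (finitely many) cosets and \<open>\<rho>\<close> chooses representatives.\<close>

definition relations3 :: "('r::idom fract \<times> 'r fract) proj_relation set" where
  "relations3 =
     {map (\<lambda>C. (1, [(to_fract (\<rho> C), to_fract m)])) Cs @ [(-1, [])] | m Cs \<rho>.
        m \<noteq> 0 \<and> distinct Cs \<and> set Cs = principal_cosets m \<and> (\<forall>C\<in>principal_cosets m. \<rho> C \<in> C)}"

end

theory Submission
  imports Defs "HOL-Analysis.Urysohn"
begin

text \<open>
  Both sides of the claim are bounded linear maps from \<open>A\<close> to \<open>P\<close>, so it suffices to compare
  them on words in the generators \<open>s m\<close>, \<open>u n\<close> and their adjoints, whose span is dense.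
  Under \<open>\<Psi>\<close> such a word becomes a word in the partial representation \<open>\<pi>\<close> of the affine group.

  In a partial representation one has \<open>\<pi> g \<pi> h = \<pi> (g h) e\<close> with \<open>e\<close> the range projection of the
  inverse of \<open>h\<close>. Hence every word in \<open>\<pi>\<close> equals \<open>\<pi> g\<close> times a product of range projections,
  where \<open>g\<close> is the product of the letters in the group (\<open>partial_word\<close>). Writing the entries of
  \<open>g\<close> over a common denominator, \<open>g = (n/c, m/c)\<close>, the relations make \<open>\<pi> g\<close> the image of
  \<open>s c\<^sup>* u n s m\<close> (\<open>factorization\<close>), and so the range projection of \<open>g\<close> is the image of
  \<open>s c\<^sup>* u n s m s m\<^sup>* u (-n) s c\<close>. The formula for \<open>\<Theta>\<close> says that the latter element is fixed,
  so it lies in the range \<open>D\<close> of \<open>\<Theta>\<close>. Therefore every word of \<open>A\<close> has the form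
  \<open>s c\<^sup>* u n s m d\<close> with \<open>d \<in> D\<close>. As \<open>\<Theta>\<close> is a right \<open>D\<close>-module map, it fixes the word if
  \<open>n = 0\<close> and \<open>m = c\<close>, and kills it otherwise. The first case says exactly that \<open>g\<close> is the
  identity, which is also the condition under which \<open>E\<close> fixes the image of the word instead of
  killing it.

  The boundedness of \<open>\<Psi>\<close> is the analytic ingredient (\<open>cstar_hom_contractive\<close>). It rests on the fact
  that a self-adjoint \<open>x\<close> of norm less than 1 is the mean of the unitaries \<open>x \<plusminus> i y\<close> with
  \<open>y = \<surd>(1 - x\<^sup>2)\<close>, and *-homomorphisms send unitaries to unitaries, which have norm at most 1.
\<close>

section \<open>Elementary calculus in a unital C*-algebra\<close>

context cstar_algebra
begin

lemma scalar_closed [simp]: "x \<in> carrier A \<Longrightarrow> c \<odot> x \<in> carrier A"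
  using smult_closed[of c x] by (simp add: complex_ring_def)

lemma scalar_add_left: "x \<in> carrier A \<Longrightarrow> (a + b) \<odot> x = a \<odot> x \<oplus> b \<odot> x"
  using smult_l_distr[of a b x] by (simp add: complex_ring_def)

lemma scalar_add_right: "\<lbrakk>x \<in> carrier A; y \<in> carrier A\<rbrakk> \<Longrightarrow> c \<odot> (x \<oplus> y) = c \<odot> x \<oplus> c \<odot> y"
  using smult_r_distr[of c x y] by (simp add: complex_ring_def)

lemma scalar_scalar: "x \<in> carrier A \<Longrightarrow> a \<odot> (b \<odot> x) = (a * b) \<odot> x"
  using smult_assoc1[of a b x] by (simp add: complex_ring_def)

lemma scalar_one [simp]: "x \<in> carrier A \<Longrightarrow> 1 \<odot> x = x"
  using smult_one[of x] by (simp add: complex_ring_def)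

lemma scalar_zero_left [simp]: "x \<in> carrier A \<Longrightarrow> 0 \<odot> x = \<zero>"
  using smult_l_null[of x] by (simp add: complex_ring_def)

lemma scalar_minus_one: "x \<in> carrier A \<Longrightarrow> (-1) \<odot> x = \<ominus> x"
  using scalar_add_left[of x "-1" 1] minus_equality[of "(-1) \<odot> x" x] by simp

lemma scalar_minus_right: "x \<in> carrier A \<Longrightarrow> c \<odot> (\<ominus> x) = \<ominus> (c \<odot> x)"
  by (simp add: scalar_minus_one[symmetric] scalar_scalar)

lemma star_in_carrier [simp]: "x \<in> carrier A \<Longrightarrow> star A x \<in> carrier A"
  by (rule star_closed)

lemma star_one [simp]: "star A \<one> = \<one>"
  using star_mult[of "star A \<one>" \<one>] star_star[of \<one>] by simp

lemma star_minus: "x \<in> carrier A \<Longrightarrow> star A (\<ominus> x) = \<ominus> star A x"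
  using star_smult[of x "-1"] by (simp add: scalar_minus_one)

lemma eq_of_diff_zero:
  assumes "x \<in> carrier A" "y \<in> carrier A" "x \<ominus> y = \<zero>"
  shows "x = y"
  using assms minus_equality[of x "\<ominus> y"] by (simp add: a_minus_def)

lemma isometric_idempotent_eq_one:
  assumes "v \<in> carrier A" "star A v \<otimes> v = \<one>" "v \<otimes> v = v"
  shows "v = \<one>"
  using m_assoc[of "star A v" v v] assms by simp

lemma cnorm_one_le: "cnorm A \<one> \<le> 1"
proof -
  have "cnorm A \<one> = (cnorm A \<one>)\<^sup>2"
    using cstar_identity[of \<one>] by simp
  then show ?thesis
    by (metis dual_order.refl mult_cancel_left1 power2_eq_square zero_le_one)
qed

lemma cnorm_star [simp]:
  assumes x: "x \<in> carrier A"
  shows "cnorm A (star A x) = cnorm A x"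
proof -
  have le: "cnorm A y \<le> cnorm A (star A y)" if y: "y \<in> carrier A" for y
  proof (cases "cnorm A y = 0")
    case False
    then have pos: "cnorm A y > 0" using cnorm_nonneg[OF y] by simp
    have "cnorm A y * cnorm A y \<le> cnorm A (star A y) * cnorm A y"
      using cstar_identity[OF y] cnorm_mult[of "star A y" y] y by (simp add: power2_eq_square)
    then show ?thesis using pos by simp
  qed (use cnorm_nonneg y in simp)
  show ?thesis
    using le[OF x] le[of "star A x"] star_star[OF x] x by (simp add: antisym)
qed

lemma cnorm_minus: "x \<in> carrier A \<Longrightarrow> cnorm A (\<ominus> x) = cnorm A x"
  using cnorm_smult[of x "-1"] by (simp add: scalar_minus_one)

lemma cnorm_diff_triangle:
  "\<lbrakk>x \<in> carrier A; y \<in> carrier A\<rbrakk> \<Longrightarrow> cnorm A (x \<ominus> y) \<le> cnorm A x + cnorm A y"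
  using cnorm_triangle[of x "\<ominus> y"] by (simp add: a_minus_def cnorm_minus)

lemma cnorm_isometry_le_one:
  assumes "v \<in> carrier A" "star A v \<otimes> v = \<one>"
  shows "cnorm A v \<le> 1"
  using cstar_identity[OF assms(1)] cnorm_one_le assms cnorm_nonneg[of v]
  by (simp add: power_le_one_iff)

text \<open>The Lipschitz estimate that makes \<open>z \<mapsto> (h + z\<^sup>2)/2\<close> a contraction of the ball of
  radius \<open>r < 1\<close>; it follows from \<open>x\<^sup>2 - y\<^sup>2 = x (x - y) + (x - y) y\<close>.\<close>

lemma cnorm_half_square_diff_le:
  assumes x: "x \<in> carrier A" "cnorm A x \<le> r" and y: "y \<in> carrier A" "cnorm A y \<le> r"
  shows "cnorm A ((1/2) \<odot> (x \<otimes> x \<ominus> y \<otimes> y)) \<le> r * cnorm A (x \<ominus> y)"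
proof -
  have xy: "x \<ominus> y \<in> carrier A" using x y by simp
  have "x \<otimes> x \<ominus> y \<otimes> y = x \<otimes> (x \<ominus> y) \<oplus> (x \<ominus> y) \<otimes> y"
    using x(1) y(1) by (simp add: a_minus_def l_distr r_distr l_minus r_minus a_assoc r_neg1 r_neg2)
  then have "cnorm A (x \<otimes> x \<ominus> y \<otimes> y) \<le> cnorm A (x \<otimes> (x \<ominus> y)) + cnorm A ((x \<ominus> y) \<otimes> y)"
    using cnorm_triangle x y xy by simp
  also have "\<dots> \<le> cnorm A x * cnorm A (x \<ominus> y) + cnorm A (x \<ominus> y) * cnorm A y"
    using cnorm_mult x y xy by (simp add: add_mono)
  also have "\<dots> \<le> r * cnorm A (x \<ominus> y) + cnorm A (x \<ominus> y) * r"
    using x y cnorm_nonneg[OF xy] by (intro add_mono mult_right_mono mult_left_mono)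
  finally show ?thesis
    using x y by (simp add: cnorm_smult)
qed

lemma ball_mcomplete: "Metric_space.mcomplete {z \<in> carrier A. cnorm A z \<le> r} (cdist A)"
proof -
  interpret Metric_space "carrier A" "cdist A" by (rule Metric_space_cdist)
  have ball: "{z \<in> carrier A. cnorm A z \<le> r} = mcball \<zero> r"
    by (auto simp: mcball_def cdist_def a_minus_def cnorm_minus)
  interpret sub: Submetric "carrier A" "cdist A" "{z \<in> carrier A. cnorm A z \<le> r}"
    by unfold_locales auto
  show ?thesis
    using sub.closedin_mcomplete_imp_mcomplete complete unfolding ball by simp
qed

text \<open>The equation \<open>(1 - z)\<^sup>2 = 1 - h\<close> says that \<open>z\<close> is a fixed point of \<open>z \<mapsto> (h + z\<^sup>2)/2\<close>, which
  is a contraction of the ball of radius \<open>\<parallel>h\<parallel> < 1\<close>. Uniqueness of the fixed point makes it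
  self-adjoint, and a commutator estimate shows that it commutes with everything that commutes
  with \<open>h\<close>.\<close>

lemma sqrt_one_minus:
  assumes h: "h \<in> carrier A" "star A h = h" "cnorm A h < 1"
  obtains y where "y \<in> carrier A" "star A y = y" "y \<otimes> y = \<one> \<ominus> h"
    "\<And>x. \<lbrakk>x \<in> carrier A; x \<otimes> h = h \<otimes> x\<rbrakk> \<Longrightarrow> x \<otimes> y = y \<otimes> x"
proof -
  define r where "r = cnorm A h"
  define M where "M = {z \<in> carrier A. cnorm A z \<le> r}"
  define f where "f z = (1/2) \<odot> (h \<oplus> z \<otimes> z)" for z
  have r: "0 \<le> r" "r < 1" using h cnorm_nonneg by (simp_all add: r_def)
  have f_diff: "f x \<ominus> f y = (1/2) \<odot> (x \<otimes> x \<ominus> y \<otimes> y)"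
    if "x \<in> carrier A" "y \<in> carrier A" for x y
  proof -
    have "f x \<ominus> f y = (1/2) \<odot> ((h \<oplus> x \<otimes> x) \<ominus> (h \<oplus> y \<otimes> y))"
      using that h by (simp add: f_def a_minus_def scalar_add_right scalar_minus_right)
    also have "(h \<oplus> x \<otimes> x) \<ominus> (h \<oplus> y \<otimes> y) = x \<otimes> x \<ominus> y \<otimes> y"
      using that h by (simp add: a_minus_def minus_add a_ac r_neg1 r_neg2)
    finally show ?thesis .
  qed
  have f_contr: "cnorm A (f x \<ominus> f y) \<le> r * cnorm A (x \<ominus> y)" if "x \<in> M" "y \<in> M" for x y
    using that f_diff cnorm_half_square_diff_le by (simp add: M_def)
  have f_M: "f z \<in> M" if "z \<in> M" for z
  proof -
    have z: "z \<in> carrier A" "cnorm A z \<le> r" using that by (auto simp: M_def)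
    have "cnorm A (f z) \<le> (cnorm A h + cnorm A (z \<otimes> z)) / 2"
      using z h cnorm_triangle[of h "z \<otimes> z"] by (simp add: f_def cnorm_smult)
    also have "cnorm A (z \<otimes> z) \<le> r * r"
      using cnorm_mult[of z z] z cnorm_nonneg[of z] mult_mono[of "cnorm A z" r "cnorm A z" r] r
      by simp
    also have "(cnorm A h + r * r) / 2 \<le> r"
      using r mult_left_mono[of r 1 r] by (simp add: r_def)
    finally show ?thesis using z h by (simp add: M_def f_def)
  qed
  interpret M: Metric_space M "cdist A"
    using Metric_space.subspace[OF Metric_space_cdist, of M] by (simp add: M_def subset_iff)
  obtain z where z: "z \<in> M" "f z = z"
  proof (rule M.Banach_fixedpoint_thm[of f r])
    show "M.mcomplete" unfolding M_def by (rule ball_mcomplete)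
    show "M \<noteq> {}" using h by (auto simp: M_def r_def)
    show "f \<in> M \<rightarrow> M" using f_M by simp
    show "cdist A (f x) (f y) \<le> r * cdist A x y" if "x \<in> M" "y \<in> M" for x y
      using that f_contr f_M by (simp add: cdist_def M_def)
  qed (use r in auto)
  have zc: "z \<in> carrier A" "cnorm A z \<le> r" using z by (auto simp: M_def)
  have zz: "h \<oplus> z \<otimes> z = z \<oplus> z"
  proof -
    have "h \<oplus> z \<otimes> z = 2 \<odot> f z" using h zc by (simp add: f_def scalar_scalar)
    also have "\<dots> = z \<oplus> z" using z scalar_add_left[of z 1 1] zc by simp
    finally show ?thesis .
  qed
  have "star A (f z) = f (star A z)"
    using h zc by (simp add: f_def star_smult star_add star_mult)
  then have "f (star A z) = star A z" using z by simp
  moreover have "star A z \<in> M" using zc by (simp add: M_def)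
  ultimately have star_z: "star A z = z"
    using M.contraction_imp_unique_fixpoint[of f "star A z" z r] z f_M f_contr r
    by (simp add: cdist_def M_def)
  have comm: "x \<otimes> z = z \<otimes> x" if x: "x \<in> carrier A" "x \<otimes> h = h \<otimes> x" for x
  proof -
    define c where "c = x \<otimes> z \<ominus> z \<otimes> x"
    have c: "c \<in> carrier A" using x zc by (simp add: c_def)
    \<comment> \<open>Taking the commutator with \<open>x\<close> in \<open>2 z = h + z\<^sup>2\<close> gives \<open>2 c = z c + c z\<close>, and \<open>\<parallel>z\<parallel> < 1\<close>
      then forces \<open>c = 0\<close>.\<close>
    have "x \<otimes> (h \<oplus> z \<otimes> z) \<ominus> (h \<oplus> z \<otimes> z) \<otimes> x = z \<otimes> c \<oplus> c \<otimes> z"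
      using x zc h by (simp add: c_def a_minus_def l_distr r_distr l_minus r_minus minus_add a_ac m_assoc r_neg1 r_neg2 r_neg l_neg)
    then have "c \<oplus> c = z \<otimes> c \<oplus> c \<otimes> z" 
      unfolding zz using x zc 
      by (simp add: c_def a_minus_def l_distr r_distr minus_add a_ac)
    moreover have "c \<oplus> c = 2 \<odot> c" using scalar_add_left[of c 1 1] c by simp
    ultimately have "2 * cnorm A c = cnorm A (z \<otimes> c \<oplus> c \<otimes> z)"
      using cnorm_smult[of c 2] c by simp
    also have "\<dots> \<le> cnorm A z * cnorm A c + cnorm A c * cnorm A z"
      using cnorm_triangle[of "z \<otimes> c" "c \<otimes> z"] cnorm_mult[of z c] cnorm_mult[of c z] c zc
      by (simp add: mult.commute)
    also have "\<dots> \<le> 2 * (r * cnorm A c)"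
      using zc mult_right_mono[OF zc(2) cnorm_nonneg[OF c]] by (simp add: mult.commute)
    finally have "(1 - r) * cnorm A c \<le> 0" by (simp add: algebra_simps)
    then have "cnorm A c = 0"
      using r cnorm_nonneg[OF c] by (simp add: mult_le_0_iff)
    then have "c = \<zero>" using cnorm_eq_zero_iff c by simp
    then show ?thesis using x zc eq_of_diff_zero unfolding c_def by simp
  qed
  show ?thesis
  proof (rule that[of "\<one> \<ominus> z"])
    show "\<one> \<ominus> z \<in> carrier A" using zc by simp
    show "star A (\<one> \<ominus> z) = \<one> \<ominus> z" using zc star_z by (simp add: a_minus_def star_add star_minus)
    have "(\<one> \<ominus> z) \<otimes> (\<one> \<ominus> z) = \<one> \<ominus> (z \<oplus> z) \<oplus> z \<otimes> z"
      using zc by (simp add: a_minus_def l_distr r_distr l_minus r_minus minus_add a_ac)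
    also have "\<dots> = \<one> \<ominus> h"
      unfolding zz[symmetric] using zc h by (simp add: a_minus_def minus_add a_ac l_neg r_neg r_neg1 r_neg2)
    finally show "(\<one> \<ominus> z) \<otimes> (\<one> \<ominus> z) = \<one> \<ominus> h" .
    show "x \<otimes> (\<one> \<ominus> z) = (\<one> \<ominus> z) \<otimes> x" if "x \<in> carrier A" "x \<otimes> h = h \<otimes> x" for x
      using comm[OF that] that zc by (simp add: a_minus_def l_distr r_distr l_minus r_minus)
  qed
qed

text \<open>The unitary is \<open>v = x + i y\<close> with \<open>y\<close> a self-adjoint square root of \<open>1 - x\<^sup>2\<close> that commutes
  with \<open>x\<close>; then \<open>v\<^sup>* = x - i y\<close> and the cross terms cancel in \<open>v\<^sup>* v = x\<^sup>2 + y\<^sup>2\<close>.\<close>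

lemma self_adjoint_average_of_unitaries:
  assumes x: "x \<in> carrier A" "star A x = x" "cnorm A x < 1"
  obtains v where "v \<in> carrier A" "star A v \<otimes> v = \<one>" "v \<otimes> star A v = \<one>"
    "x = (1/2) \<odot> (v \<oplus> star A v)"
proof -
  have "cnorm A (x \<otimes> x) < 1"
    using cstar_identity[of x] x cnorm_nonneg[of x] by (simp add: power_less_one_iff)
  moreover have "star A (x \<otimes> x) = x \<otimes> x" using x by (simp add: star_mult)
  ultimately obtain y where y: "y \<in> carrier A" "star A y = y" "y \<otimes> y = \<one> \<ominus> x \<otimes> x"
    and comm_of: "\<And>z. \<lbrakk>z \<in> carrier A; z \<otimes> (x \<otimes> x) = (x \<otimes> x) \<otimes> z\<rbrakk> \<Longrightarrow> z \<otimes> y = y \<otimes> z"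
    using sqrt_one_minus[of "x \<otimes> x"] x(1) by blast
  have comm: "x \<otimes> y = y \<otimes> x" using comm_of[of x] x(1) by (simp add: m_assoc)
  define v where "v = x \<oplus> \<i> \<odot> y"
  define w where "w = x \<oplus> (-\<i>) \<odot> y"
  have sum: "x \<otimes> x \<oplus> y \<otimes> y = \<one>"
    using x y(1) unfolding y(3) by (simp add: a_minus_def a_ac r_neg1 r_neg2 r_neg l_neg)
  have cancel: "a \<odot> z \<oplus> (-a) \<odot> z = \<zero>" "(-a) \<odot> z \<oplus> a \<odot> z = \<zero>" if "z \<in> carrier A" for a z
    using scalar_add_left[of z a "-a"] scalar_add_left[of z "-a" a] that by simp_all
  \<comment> \<open>Used for \<open>a = i\<close> and \<open>a = -i\<close>, which gives both orders of the product of \<open>v\<close> and \<open>v\<^sup>*\<close>.\<close>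
  have expand: "(x \<oplus> a \<odot> y) \<otimes> (x \<oplus> (-a) \<odot> y) = \<one>" if a: "a * (-a) = 1" for a
  proof -
    have "(x \<oplus> a \<odot> y) \<otimes> (x \<oplus> (-a) \<odot> y) =
        (x \<otimes> x \<oplus> a \<odot> (x \<otimes> y)) \<oplus> ((-a) \<odot> (x \<otimes> y) \<oplus> (a * (-a)) \<odot> (y \<otimes> y))"
      using x(1) y(1) comm
      by (simp add: l_distr r_distr smult_mult_left smult_mult_right scalar_scalar
          scalar_add_right a_assoc del: mult_minus_right)
    also have "\<dots> = x \<otimes> x \<oplus> ((a \<odot> (x \<otimes> y) \<oplus> (-a) \<odot> (x \<otimes> y)) \<oplus> y \<otimes> y)"
      unfolding a using x(1) y(1) by (simp add: a_assoc)
    also have "\<dots> = \<one>" using x(1) y(1) sum by (simp add: cancel)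
    finally show ?thesis .
  qed
  have vw: "v \<otimes> w = \<one>" "w \<otimes> v = \<one>"
    using expand[of \<i>] expand[of "-\<i>"] by (simp_all add: v_def w_def)
  have star_v: "star A v = w" using x y by (simp add: v_def w_def star_add star_smult)
  have "v \<oplus> w = (x \<oplus> x) \<oplus> (\<i> \<odot> y \<oplus> (-\<i>) \<odot> y)"
    using x y(1) by (simp add: v_def w_def a_ac)
  also have "\<dots> = 2 \<odot> x"
    using x y(1) scalar_add_left[of x 1 1] by (simp add: cancel)
  finally have x_eq: "x = (1/2) \<odot> (v \<oplus> star A v)" using x star_v by (simp add: scalar_scalar)
  have "v \<in> carrier A" using x y(1) by (simp add: v_def)
  then show ?thesis using vw x_eq unfolding star_v[symmetric] by (intro that)
qed

end

section \<open>Homomorphisms of C*-algebras are contractive\<close>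

lemma cstar_homD:
  assumes "\<phi> \<in> cstar_hom A B"
  shows "x \<in> carrier A \<Longrightarrow> \<phi> x \<in> carrier B"
    and "\<lbrakk>x \<in> carrier A; y \<in> carrier A\<rbrakk> \<Longrightarrow> \<phi> (x \<oplus>\<^bsub>A\<^esub> y) = \<phi> x \<oplus>\<^bsub>B\<^esub> \<phi> y"
    and "\<lbrakk>x \<in> carrier A; y \<in> carrier A\<rbrakk> \<Longrightarrow> \<phi> (x \<otimes>\<^bsub>A\<^esub> y) = \<phi> x \<otimes>\<^bsub>B\<^esub> \<phi> y"
    and "\<phi> \<one>\<^bsub>A\<^esub> = \<one>\<^bsub>B\<^esub>"
    and "x \<in> carrier A \<Longrightarrow> \<phi> (c \<odot>\<^bsub>A\<^esub> x) = c \<odot>\<^bsub>B\<^esub> \<phi> x"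
    and "x \<in> carrier A \<Longrightarrow> \<phi> (star A x) = star B (\<phi> x)"
  using assms unfolding cstar_hom_def
  by (auto simp: ring_hom_closed ring_hom_add ring_hom_mult ring_hom_one)

text \<open>For a self-adjoint element of norm less than 1 the bound 1 on the image comes from the
  decomposition into unitaries; scaling gives all self-adjoint elements, and the C*-identity
  applied to \<open>x\<^sup>* x\<close> gives all elements.\<close>

lemma cstar_hom_contractive:
  assumes A: "cstar_algebra A" and B: "cstar_algebra B" and \<phi>: "\<phi> \<in> cstar_hom A B"
    and x: "x \<in> carrier A"
  shows "cnorm B (\<phi> x) \<le> cnorm A x"
proof -
  interpret A: cstar_algebra A by (rule A)
  interpret B: cstar_algebra B by (rule B)
  note hom = cstar_homD[OF \<phi>]
  have unit_ball: "cnorm B (\<phi> h) \<le> 1"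
    if h: "h \<in> carrier A" "star A h = h" "cnorm A h < 1" for h
  proof -
    obtain v where v: "v \<in> carrier A" "star A v \<otimes>\<^bsub>A\<^esub> v = \<one>\<^bsub>A\<^esub>"
      and h_eq: "h = (1/2) \<odot>\<^bsub>A\<^esub> (v \<oplus>\<^bsub>A\<^esub> star A v)"
      using A.self_adjoint_average_of_unitaries[OF h] by metis
    have v': "\<phi> v \<in> carrier B" "star B (\<phi> v) \<otimes>\<^bsub>B\<^esub> \<phi> v = \<one>\<^bsub>B\<^esub>"
      using v hom by (metis A.star_closed)+
    have "\<phi> h = (1/2) \<odot>\<^bsub>B\<^esub> (\<phi> v \<oplus>\<^bsub>B\<^esub> star B (\<phi> v))"
      using v(1) by (simp add: h_eq hom)
    then have "cnorm B (\<phi> h) \<le> (cnorm B (\<phi> v) + cnorm B (star B (\<phi> v))) / 2"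
      using v'(1) B.cnorm_triangle[of "\<phi> v" "star B (\<phi> v)"] by (simp add: B.cnorm_smult)
    then show ?thesis using B.cnorm_isometry_le_one[OF v'] v'(1) by simp
  qed
  have self_adjoint: "cnorm B (\<phi> h) \<le> cnorm A h"
    if h: "h \<in> carrier A" "star A h = h" for h
  proof (rule dense_ge)
    fix t assume t: "cnorm A h < t"
    then have "t > 0" using A.cnorm_nonneg[OF h(1)] by simp
    define k where "k = complex_of_real (1 / t) \<odot>\<^bsub>A\<^esub> h"
    have "k \<in> carrier A" "star A k = k" "cnorm A k < 1"
      using h t \<open>t > 0\<close> by (simp_all add: k_def A.star_smult A.cnorm_smult norm_divide)
    then have "cnorm B (\<phi> k) \<le> 1" by (rule unit_ball)
    then show "cnorm B (\<phi> h) \<le> t"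
      using h \<open>t > 0\<close> by (simp add: k_def hom B.cnorm_smult norm_divide pos_divide_le_eq)
  qed
  have "(cnorm B (\<phi> x))\<^sup>2 = cnorm B (\<phi> (star A x \<otimes>\<^bsub>A\<^esub> x))"
    using x B.cstar_identity[of "\<phi> x"] by (simp add: hom)
  also have "\<dots> \<le> cnorm A (star A x \<otimes>\<^bsub>A\<^esub> x)"
    using x by (intro self_adjoint) (simp_all add: A.star_mult A.star_star)
  also have "\<dots> = (cnorm A x)\<^sup>2" using x by (rule A.cstar_identity)
  finally show ?thesis using A.cnorm_nonneg[OF x] by (rule power2_le_imp_le)
qed

section \<open>Bounded maps and generated subalgebras\<close>

definition closed_subspace :: "'a cstar \<Rightarrow> 'a set \<Rightarrow> bool" where
  "closed_subspace A V \<longleftrightarrow> V \<subseteq> carrier A \<and> \<zero>\<^bsub>A\<^esub> \<in> V \<and>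
     (\<forall>x\<in>V. \<forall>y\<in>V. x \<oplus>\<^bsub>A\<^esub> y \<in> V) \<and> (\<forall>c. \<forall>x\<in>V. c \<odot>\<^bsub>A\<^esub> x \<in> V) \<and>
     closedin (Metric_space.mtopology (carrier A) (cdist A)) V"

text \<open>The twist \<open>\<tau>\<close> of the scalars allows the adjoint operation (\<open>\<tau> = cnj\<close>) to be treated together
  with linear maps (\<open>\<tau> = id\<close>).\<close>

definition bounded_semilinear ::
    "'a cstar \<Rightarrow> 'b cstar \<Rightarrow> (complex \<Rightarrow> complex) \<Rightarrow> ('a \<Rightarrow> 'b) \<Rightarrow> bool" where
  "bounded_semilinear A B \<tau> f \<longleftrightarrow> f \<in> carrier A \<rightarrow> carrier B \<and>
     (\<forall>x\<in>carrier A. \<forall>y\<in>carrier A. f (x \<oplus>\<^bsub>A\<^esub> y) = f x \<oplus>\<^bsub>B\<^esub> f y) \<and>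
     (\<forall>c. \<forall>x\<in>carrier A. f (c \<odot>\<^bsub>A\<^esub> x) = \<tau> c \<odot>\<^bsub>B\<^esub> f x) \<and>
     (\<exists>K. \<forall>x\<in>carrier A. cnorm B (f x) \<le> K * cnorm A x)"

lemma closed_subspace_preimage:
  assumes A: "cstar_algebra A" and B: "cstar_algebra B"
    and f: "bounded_semilinear A B \<tau> f" and V: "closed_subspace B V"
  shows "closed_subspace A {x \<in> carrier A. f x \<in> V}"
proof -
  interpret A: cstar_algebra A by (rule A)
  interpret B: cstar_algebra B by (rule B)
  interpret MA: Metric_space "carrier A" "cdist A" by (rule A.Metric_space_cdist)
  interpret MB: Metric_space "carrier B" "cdist B" by (rule B.Metric_space_cdist)
  have f_closed: "\<And>x. x \<in> carrier A \<Longrightarrow> f x \<in> carrier B"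
    and f_add: "\<And>x y. \<lbrakk>x \<in> carrier A; y \<in> carrier A\<rbrakk> \<Longrightarrow> f (x \<oplus>\<^bsub>A\<^esub> y) = f x \<oplus>\<^bsub>B\<^esub> f y"
    and f_smult: "\<And>c x. x \<in> carrier A \<Longrightarrow> f (c \<odot>\<^bsub>A\<^esub> x) = \<tau> c \<odot>\<^bsub>B\<^esub> f x"
    using f by (auto simp: bounded_semilinear_def)
  obtain K where "\<forall>x\<in>carrier A. cnorm B (f x) \<le> K * cnorm A x"
    using f unfolding bounded_semilinear_def by (elim conjE exE) (rule that)
  then have K: "\<And>x. x \<in> carrier A \<Longrightarrow> cnorm B (f x) \<le> K * cnorm A x" by simp
  have f_zero: "f \<zero>\<^bsub>A\<^esub> = \<zero>\<^bsub>B\<^esub>"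
    using f_add[of "\<zero>\<^bsub>A\<^esub>" "\<zero>\<^bsub>A\<^esub>"] f_closed[of "\<zero>\<^bsub>A\<^esub>"]
      B.add.l_cancel_one[of "f \<zero>\<^bsub>A\<^esub>" "f \<zero>\<^bsub>A\<^esub>"] by simp
  have f_diff: "f (x \<ominus>\<^bsub>A\<^esub> y) = f x \<ominus>\<^bsub>B\<^esub> f y" if xy: "x \<in> carrier A" "y \<in> carrier A" for x y
  proof -
    have "(x \<ominus>\<^bsub>A\<^esub> y) \<oplus>\<^bsub>A\<^esub> y = x"
      using xy by (simp add: a_minus_def A.a_assoc A.l_neg)
    then have "f x = f (x \<ominus>\<^bsub>A\<^esub> y) \<oplus>\<^bsub>B\<^esub> f y"
      using f_add[of "x \<ominus>\<^bsub>A\<^esub> y" y] xy by simp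
    then show ?thesis
      using f_closed[of "x \<ominus>\<^bsub>A\<^esub> y"] f_closed[of y] xy
      by (simp add: a_minus_def B.a_assoc B.r_neg)
  qed
  have dist: "cdist B (f x) (f y) \<le> K * cdist A x y" if "x \<in> carrier A" "y \<in> carrier A" for x y
    using K[of "x \<ominus>\<^bsub>A\<^esub> y"] f_diff that f_closed by (simp add: cdist_def)
  have "closedin MA.mtopology {x \<in> carrier A. f x \<in> V}"
    unfolding MA.metric_closedin_iff_sequentially_closed
  proof (intro conjI allI impI)
    fix \<sigma> l
    assume "range \<sigma> \<subseteq> {x \<in> carrier A. f x \<in> V} \<and> limitin MA.mtopology \<sigma> l sequentially"
    then have \<sigma>: "\<And>n. \<sigma> n \<in> carrier A" "\<And>n. f (\<sigma> n) \<in> V" and l: "l \<in> carrier A"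
      and lim: "(\<lambda>n. cdist A (\<sigma> n) l) \<longlonglongrightarrow> 0"
      by (auto simp: MA.limitin_metric_dist_null)
    have "(\<lambda>n. cdist B (f (\<sigma> n)) (f l)) \<longlonglongrightarrow> 0"
    proof (rule tendsto_sandwich[OF _ _ tendsto_const])
      show "(\<lambda>n. K * cdist A (\<sigma> n) l) \<longlonglongrightarrow> 0"
        using tendsto_mult_left[OF lim, of K] by simp
    qed (use dist \<sigma> l in auto)
    then have "limitin MB.mtopology (\<lambda>n. f (\<sigma> n)) (f l) sequentially"
      using f_closed \<sigma> l by (simp add: MB.limitin_metric_dist_null)
    moreover have "closedin MB.mtopology V" using V by (simp add: closed_subspace_def)
    ultimately have "f l \<in> V"
      using \<sigma>(2) MB.metric_closedin_iff_sequentially_closed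
          [THEN iffD1, THEN conjunct2, rule_format, of V "\<lambda>n. f (\<sigma> n)" "f l"]
      by (simp add: image_subset_iff)
    then show "l \<in> {x \<in> carrier A. f x \<in> V}" using l by simp
  qed auto
  then show ?thesis
    using V f_add f_smult f_zero by (simp add: closed_subspace_def)
qed

context cstar_algebra
begin

lemma bounded_left_mult: "a \<in> carrier A \<Longrightarrow> bounded_semilinear A A id (\<lambda>x. a \<otimes> x)"
  using cnorm_mult by (auto simp: bounded_semilinear_def r_distr smult_mult_right)

lemma bounded_right_mult: "a \<in> carrier A \<Longrightarrow> bounded_semilinear A A id (\<lambda>x. x \<otimes> a)"
  using cnorm_mult
  by (auto simp: bounded_semilinear_def l_distr smult_mult_left intro!: exI[of _ "cnorm A a"])
    (metis mult.commute)

lemma bounded_star: "bounded_semilinear A A cnj (star A)"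
  by (auto simp: bounded_semilinear_def star_add star_smult intro!: exI[of _ 1])

lemma closed_subspace_zero: "closed_subspace A {\<zero>}"
proof -
  interpret Metric_space "carrier A" "cdist A" by (rule Metric_space_cdist)
  have "c \<odot> \<zero> = \<zero>" for c
    using smult_r_null[of c] by (simp add: complex_ring_def)
  then show ?thesis
    using closedin_Hausdorff_sing_eq[OF Hausdorff_space_mtopology]
    by (simp add: closed_subspace_def)
qed

lemma closed_subspace_Inter:
  assumes "\<V> \<noteq> {}" "\<And>V. V \<in> \<V> \<Longrightarrow> closed_subspace A V"
  shows "closed_subspace A (\<Inter>\<V>)"
proof -
  have "closedin (Metric_space.mtopology (carrier A) (cdist A)) (\<Inter>\<V>)"
    using assms by (intro closedin_Inter) (auto simp: closed_subspace_def)
  then show ?thesis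
    using assms unfolding closed_subspace_def by blast
qed

lemma list_prod_closed [simp]: "set xs \<subseteq> carrier A \<Longrightarrow> list_prod A xs \<in> carrier A"
  by (induction xs) (auto simp: list_prod_def)

lemma list_prod_append:
  "\<lbrakk>set xs \<subseteq> carrier A; set ys \<subseteq> carrier A\<rbrakk>
     \<Longrightarrow> list_prod A (xs @ ys) = list_prod A xs \<otimes> list_prod A ys"
proof (induction xs)
  case Nil
  then show ?case using list_prod_closed[of ys] by (simp add: list_prod_def)
next
  case (Cons x xs)
  then show ?case
    using list_prod_closed[of xs] list_prod_closed[of ys] by (simp add: list_prod_def m_assoc)
qed

lemma star_list_prod:
  "set xs \<subseteq> carrier A \<Longrightarrow> star A (list_prod A xs) = list_prod A (rev (map (star A) xs))"
proof (induction xs)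
  case (Cons x xs)
  have "star A (list_prod A (x # xs)) = star A (list_prod A xs) \<otimes> star A x"
    using Cons.prems list_prod_closed[of xs] by (simp add: list_prod_def star_mult)
  also have "\<dots> = list_prod A (rev (map (star A) xs) @ [star A x])"
    using Cons by (subst list_prod_append) (auto simp: list_prod_def)
  finally show ?case by simp
qed (simp add: list_prod_def)

text \<open>The closed span \<open>C\<close> of the words in a self-adjoint set is a C*-subalgebra. Its closure under
  products and adjoints is obtained without limits of products: preimages of \<open>C\<close> under one-sided
  multiplications and under the adjoint are closed subspaces, so they contain \<open>C\<close> as soon as they
  contain the words.\<close>

lemma generated_subset_closed_subspace:
  assumes S: "S \<subseteq> carrier A" "star A ` S \<subseteq> S"
    and V: "closed_subspace A V" "\<And>xs. set xs \<subseteq> S \<Longrightarrow> list_prod A xs \<in> V"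
  shows "cstar_generated A S \<subseteq> V"
proof -
  note cstar = cstar_algebra_axioms
  define W where "W = {list_prod A xs | xs. set xs \<subseteq> S}"
  define C where "C = \<Inter>{U. closed_subspace A U \<and> W \<subseteq> U}"
  have "V \<in> {U. closed_subspace A U \<and> W \<subseteq> U}" using V by (auto simp: W_def)
  then have C: "closed_subspace A C" and CV: "C \<subseteq> V"
    unfolding C_def by (auto intro: closed_subspace_Inter)
  have WC: "W \<subseteq> C" by (auto simp: C_def)
  have C_least: "C \<subseteq> U" if "closed_subspace A U" "W \<subseteq> U" for U
    using that by (auto simp: C_def)
  have C_carrier: "C \<subseteq> carrier A" using C by (simp add: closed_subspace_def)
  have W_mult: "x \<otimes> y \<in> W" if xy: "x \<in> W" "y \<in> W" for x y
  proof -
    obtain xs ys where "x = list_prod A xs" "set xs \<subseteq> S" "y = list_prod A ys" "set ys \<subseteq> S"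
      using xy unfolding W_def by blast
    then show ?thesis
      using S list_prod_append[of xs ys] by (auto simp: W_def intro!: exI[of _ "xs @ ys"])
  qed
  have W_star: "star A x \<in> W" if x: "x \<in> W" for x
  proof -
    obtain xs where "x = list_prod A xs" "set xs \<subseteq> S" using x by (auto simp: W_def)
    moreover from this S have "set (rev (map (star A) xs)) \<subseteq> S" "set xs \<subseteq> carrier A" by auto
    ultimately show ?thesis using star_list_prod[of xs] unfolding W_def by blast
  qed
  have C_mult_W: "x \<otimes> w \<in> C" if x: "x \<in> C" and w: "w \<in> W" for x w
  proof -
    have "w \<in> carrier A" using w WC C_carrier by blast
    then have "C \<subseteq> {x \<in> carrier A. x \<otimes> w \<in> C}"
      using W_mult w WC C_carrier
      by (intro C_least closed_subspace_preimage[OF cstar cstar bounded_right_mult C]) auto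
    then show ?thesis using x by blast
  qed
  have C_mult: "x \<otimes> y \<in> C" if x: "x \<in> C" and y: "y \<in> C" for x y
  proof -
    have "x \<in> carrier A" using x C_carrier by blast
    then have "C \<subseteq> {y \<in> carrier A. x \<otimes> y \<in> C}"
      using C_mult_W x WC C_carrier
      by (intro C_least closed_subspace_preimage[OF cstar cstar bounded_left_mult C]) auto
    then show ?thesis using y by blast
  qed
  have C_star: "star A x \<in> C" if x: "x \<in> C" for x
  proof -
    have "C \<subseteq> {x \<in> carrier A. star A x \<in> C}"
      using W_star WC C_carrier
      by (intro C_least closed_subspace_preimage[OF cstar cstar bounded_star C]) auto
    then show ?thesis using x by blast
  qed
  have "S \<subseteq> W"
  proof
    fix x assume "x \<in> S"
    then show "x \<in> W"
      using S(1) by (auto simp: W_def list_prod_def subset_iff intro!: exI[of _ "[x]"])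
  qed
  moreover have "cstar_subalgebra A C"
    using C C_mult C_star by (simp add: cstar_subalgebra_def closed_subspace_def)
  ultimately have "cstar_generated A S \<subseteq> C"
    using WC by (auto simp: cstar_generated_def)
  then show ?thesis using CV by blast
qed

end

text \<open>The difference of the two maps is bounded, so its kernel is a closed subspace, and this kernel
  contains all words.\<close>

lemma bounded_maps_eq_on_generated:
  assumes A: "cstar_algebra A" and B: "cstar_algebra B"
    and f: "bounded_semilinear A B \<tau> f" and g: "bounded_semilinear A B \<tau> g"
    and S: "S \<subseteq> carrier A" "star A ` S \<subseteq> S"
    and words: "\<And>xs. set xs \<subseteq> S \<Longrightarrow> f (list_prod A xs) = g (list_prod A xs)"
    and x: "x \<in> cstar_generated A S"
  shows "f x = g x"
proof -
  interpret A: cstar_algebra A by (rule A)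
  interpret B: cstar_algebra B by (rule B)
  define d where "d x = f x \<ominus>\<^bsub>B\<^esub> g x" for x
  have closed: "f x \<in> carrier B" "g x \<in> carrier B" if "x \<in> carrier A" for x
    using f g that by (auto simp: bounded_semilinear_def)
  obtain K L where KL: "\<And>x. x \<in> carrier A \<Longrightarrow> cnorm B (f x) \<le> K * cnorm A x"
    "\<And>x. x \<in> carrier A \<Longrightarrow> cnorm B (g x) \<le> L * cnorm A x"
    using f g unfolding bounded_semilinear_def by metis
  have bound: "cnorm B (d x) \<le> (K + L) * cnorm A x" if "x \<in> carrier A" for x
    using B.cnorm_diff_triangle[of "f x" "g x"] KL[OF that] closed[OF that]
    by (simp add: d_def distrib_right)
  have "bounded_semilinear A B \<tau> d"
    unfolding bounded_semilinear_def
  proof (intro conjI ballI allI exI)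
    show "d \<in> carrier A \<rightarrow> carrier B" using closed by (simp add: d_def)
    show "d (x \<oplus>\<^bsub>A\<^esub> y) = d x \<oplus>\<^bsub>B\<^esub> d y" if "x \<in> carrier A" "y \<in> carrier A" for x y
      using f g closed that
      by (simp add: d_def bounded_semilinear_def a_minus_def B.minus_add B.a_ac)
    show "d (c \<odot>\<^bsub>A\<^esub> x) = \<tau> c \<odot>\<^bsub>B\<^esub> d x" if "x \<in> carrier A" for c x
      using f g closed that
      by (simp add: d_def bounded_semilinear_def a_minus_def B.scalar_add_right
          B.scalar_minus_right)
  qed (fact bound)
  then have "closed_subspace A {x \<in> carrier A. d x \<in> {\<zero>\<^bsub>B\<^esub>}}"
    by (rule closed_subspace_preimage[OF A B _ B.closed_subspace_zero])
  then have "cstar_generated A S \<subseteq> {x \<in> carrier A. d x \<in> {\<zero>\<^bsub>B\<^esub>}}"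
  proof (rule A.generated_subset_closed_subspace[OF S])
    fix xs assume xs: "set xs \<subseteq> S"
    then have "list_prod A xs \<in> carrier A" using S by (intro A.list_prod_closed) auto
    then show "list_prod A xs \<in> {x \<in> carrier A. d x \<in> {\<zero>\<^bsub>B\<^esub>}}"
      using words[OF xs] closed by (simp add: d_def B.r_neg a_minus_def)
  qed
  then have "x \<in> carrier A" "f x \<ominus>\<^bsub>B\<^esub> g x = \<zero>\<^bsub>B\<^esub>" using x by (auto simp: d_def)
  then show ?thesis using B.eq_of_diff_zero closed by metis
qed

section \<open>Words in a partial representation\<close>

lemma list_prod_in_group:
  assumes "group G" "set gs \<subseteq> carrier G"
  shows "list_prod G gs \<in> carrier G"
proof -
  interpret group G by fact
  show ?thesis using assms(2) by (induction gs) (auto simp: list_prod_def)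
qed

text \<open>Multiply the relation \<open>\<pi> g \<pi> h \<pi> (h\<^sup>-\<^sup>1) = \<pi> (g h) \<pi> (h\<^sup>-\<^sup>1)\<close> on the right by \<open>\<pi> h\<close>, a partial
  isometry with \<open>\<pi> h = \<pi> h \<pi> (h\<^sup>-\<^sup>1) \<pi> h\<close>.\<close>

lemma partial_mult:
  assumes G: "group G" and A: "cstar_algebra A" and \<pi>: "partial_relations G A \<pi>"
    and g: "g \<in> carrier G" and h: "h \<in> carrier G"
  shows "\<pi> g \<otimes>\<^bsub>A\<^esub> \<pi> h = \<pi> (g \<otimes>\<^bsub>G\<^esub> h) \<otimes>\<^bsub>A\<^esub> range_proj G A \<pi> (inv\<^bsub>G\<^esub> h)"
proof -
  interpret G: group G by (rule G)
  interpret A: cstar_algebra A by (rule A)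
  have closed: "\<And>k. k \<in> carrier G \<Longrightarrow> \<pi> k \<in> carrier A"
    and one: "\<pi> \<one>\<^bsub>G\<^esub> = \<one>\<^bsub>A\<^esub>"
    and rel: "\<And>k l. \<lbrakk>k \<in> carrier G; l \<in> carrier G\<rbrakk> \<Longrightarrow>
        \<pi> k \<otimes>\<^bsub>A\<^esub> \<pi> l \<otimes>\<^bsub>A\<^esub> \<pi> (inv\<^bsub>G\<^esub> l) = \<pi> (k \<otimes>\<^bsub>G\<^esub> l) \<otimes>\<^bsub>A\<^esub> \<pi> (inv\<^bsub>G\<^esub> l)"
    using \<pi> by (auto simp: partial_relations_def)
  have "\<pi> h = \<pi> h \<otimes>\<^bsub>A\<^esub> \<pi> (inv\<^bsub>G\<^esub> h) \<otimes>\<^bsub>A\<^esub> \<pi> h"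
    using rel[of h "inv\<^bsub>G\<^esub> h"] h closed one by simp
  then have "\<pi> g \<otimes>\<^bsub>A\<^esub> \<pi> h = (\<pi> g \<otimes>\<^bsub>A\<^esub> \<pi> h \<otimes>\<^bsub>A\<^esub> \<pi> (inv\<^bsub>G\<^esub> h)) \<otimes>\<^bsub>A\<^esub> \<pi> h"
    using g h closed by (metis A.m_assoc A.m_closed G.inv_closed)
  then show ?thesis
    using rel[OF g h] g h closed by (simp add: range_proj_def A.m_assoc)
qed

lemma partial_mult_unit:
  assumes G: "group G" and A: "cstar_algebra A" and \<pi>: "partial_relations G A \<pi>"
    and g: "g \<in> carrier G" and h: "h \<in> carrier G"
    and unit: "range_proj G A \<pi> (inv\<^bsub>G\<^esub> h) = \<one>\<^bsub>A\<^esub>"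
  shows "\<pi> g \<otimes>\<^bsub>A\<^esub> \<pi> h = \<pi> (g \<otimes>\<^bsub>G\<^esub> h)"
proof -
  interpret G: group G by (rule G)
  interpret A: cstar_algebra A by (rule A)
  have "\<pi> (g \<otimes>\<^bsub>G\<^esub> h) \<in> carrier A"
    using \<pi> g h by (auto simp: partial_relations_def)
  then show ?thesis using partial_mult[OF G A \<pi> g h] unit by simp
qed

text \<open>Peeling letters off at the left makes the range projections accumulate at the right of \<open>\<pi> g\<close>,
  so they never have to be moved past other letters.\<close>

lemma partial_word:
  assumes G: "group G" and A: "cstar_algebra A" and \<pi>: "partial_relations G A \<pi>"
  shows "set gs \<subseteq> carrier G \<Longrightarrow> \<exists>hs. set hs \<subseteq> carrier G \<and>
    list_prod A (map \<pi> gs) =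
      \<pi> (list_prod G gs) \<otimes>\<^bsub>A\<^esub> list_prod A (map (range_proj G A \<pi>) hs)"
proof (induction gs)
  interpret G: group G by (rule G)
  interpret A: cstar_algebra A by (rule A)
  case Nil
  then show ?case
    using \<pi> by (intro exI[of _ "[]"]) (simp add: list_prod_def partial_relations_def)
next
  interpret G: group G by (rule G)
  interpret A: cstar_algebra A by (rule A)
  case (Cons g gs)
  define p where "p = list_prod G gs"
  have p: "p \<in> carrier G" using list_prod_in_group[OF G] Cons.prems by (simp add: p_def)
  have closed: "\<pi> k \<in> carrier A" "range_proj G A \<pi> k \<in> carrier A" if "k \<in> carrier G" for k
    using \<pi> that by (auto simp: partial_relations_def range_proj_def)
  obtain hs where hs: "set hs \<subseteq> carrier G"
    "list_prod A (map \<pi> gs) = \<pi> p \<otimes>\<^bsub>A\<^esub> list_prod A (map (range_proj G A \<pi>) hs)"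
    using Cons by (auto simp: p_def)
  have d: "list_prod A (map (range_proj G A \<pi>) hs) \<in> carrier A"
    using hs(1) closed by (intro A.list_prod_closed) auto
  have g: "g \<in> carrier G" using Cons.prems by simp
  have "list_prod A (map \<pi> (g # gs)) =
      (\<pi> g \<otimes>\<^bsub>A\<^esub> \<pi> p) \<otimes>\<^bsub>A\<^esub> list_prod A (map (range_proj G A \<pi>) hs)"
    using hs(2) d p g closed by (simp add: list_prod_def A.m_assoc)
  also have "\<dots> = \<pi> (g \<otimes>\<^bsub>G\<^esub> p) \<otimes>\<^bsub>A\<^esub>
      list_prod A (map (range_proj G A \<pi>) (inv\<^bsub>G\<^esub> p # hs))"
    unfolding partial_mult[OF G A \<pi> g p]
    using d p g closed by (simp add: list_prod_def A.m_assoc)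
  finally show ?case
    using hs(1) p by (intro exI[of _ "inv\<^bsub>G\<^esub> p # hs"]) (simp add: list_prod_def p_def)
qed

text \<open>The list is the encoding of the relation that the range projection of \<open>g\<close> is the unit, the
  form shared by the relations for translations and for divisions.\<close>

lemma (in cstar_algebra) unit_relation:
  assumes "range_proj G A \<pi> g \<in> carrier A"
    and "proj_combination G A \<pi> [(1, [g]), (-1, [])] = \<zero>"
  shows "range_proj G A \<pi> g = \<one>"
proof (rule eq_of_diff_zero)
  show "range_proj G A \<pi> g \<ominus> \<one> = \<zero>"
    using assms by (simp add: proj_combination_def list_prod_def scalar_minus_one a_minus_def)
qed (use assms in auto)

section \<open>The affine group of a field of fractions\<close>

lemma affine_group_elem_cases:
  fixes g :: "'r::idom fract \<times> 'r fract"
  assumes "g \<in> carrier affine_group"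
  obtains n m c :: 'r where "m \<noteq> 0" "c \<noteq> 0" "g = (to_fract n / to_fract c, to_fract m / to_fract c)"
proof -
  obtain a w where g: "g = (a, w)" by (cases g)
  have w: "w \<noteq> 0" using assms g by (auto simp: affine_group_def)
  obtain k l where a: "a = Fract k l" "l \<noteq> 0" by (cases a)
  obtain p q where pq: "w = Fract p q" "q \<noteq> 0" by (cases w)
  have p: "p \<noteq> 0" using w pq by (auto simp: fract_collapse)
  show thesis
  proof (rule that[of "p * l" "q * l" "k * q"])
    \<comment> \<open>With \<open>a = k/l\<close> and \<open>w = p/q\<close> the common denominator is \<open>q l\<close>.\<close>
    show "g = (to_fract (k * q) / to_fract (q * l), to_fract (p * l) / to_fract (q * l))"
      using g a pq by (simp add: to_fract_def eq_fract)
  qed (use a pq p in auto)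
qed

locale affine_partial_representation = cstar_algebra P
  for P :: "'b cstar" and \<pi> :: "'r::idom fract \<times> 'r fract \<Rightarrow> 'b" +
  assumes rel: "partial_relations_with affine_group (relations1 \<union> relations2 \<union> relations3) P \<pi>"
begin

lemma partial: "partial_relations affine_group P \<pi>"
  using rel by (simp add: partial_relations_with_def)

lemma rep_closed: "g \<in> carrier affine_group \<Longrightarrow> \<pi> g \<in> carrier P"
  using partial by (simp add: partial_relations_def)

lemma rep_inv: "g \<in> carrier affine_group \<Longrightarrow> \<pi> (inv\<^bsub>affine_group\<^esub> g) = star P (\<pi> g)"
  using partial by (simp add: partial_relations_def)

lemma range_proj_closed:
  "g \<in> carrier affine_group \<Longrightarrow> range_proj affine_group P \<pi> g \<in> carrier P"
  by (simp add: range_proj_def rep_inv rep_closed)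

lemma translation_unit: "range_proj affine_group P \<pi> (to_fract n, 1) = \<one>\<^bsub>P\<^esub>"
proof (rule unit_relation)
  show "proj_combination affine_group P \<pi> [(1, [(to_fract n, 1)]), (-1, [])] = \<zero>\<^bsub>P\<^esub>"
    using rel unfolding partial_relations_with_def relations1_def by blast
qed (intro range_proj_closed, simp add: affine_group_def)

lemma division_unit:
  assumes "m \<noteq> 0"
  shows "range_proj affine_group P \<pi> (0, 1 / to_fract m) = \<one>\<^bsub>P\<^esub>"
proof (rule unit_relation)
  show "proj_combination affine_group P \<pi> [(1, [(0, 1 / to_fract m)]), (-1, [])] = \<zero>\<^bsub>P\<^esub>"
    using rel assms unfolding partial_relations_with_def relations2_def by blast
qed (intro range_proj_closed, use assms in \<open>simp add: affine_group_def\<close>)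

text \<open>In the group, \<open>(n/c, m/c) = (0, 1/c) (n, 1) (0, m)\<close>. The products on the right are preserved by
  \<open>\<pi>\<close> because the range projections of \<open>(-n, 1)\<close> and of \<open>(0, 1/m)\<close> are equal to 1.\<close>

lemma factorization:
  assumes c: "c \<noteq> 0" and m: "m \<noteq> 0"
  shows "\<pi> (to_fract n / to_fract c, to_fract m / to_fract c) =
    star P (\<pi> (0, to_fract c)) \<otimes>\<^bsub>P\<^esub> \<pi> (to_fract n, 1) \<otimes>\<^bsub>P\<^esub> \<pi> (0, to_fract m)"
proof -
  note mult = partial_mult_unit[OF affine_group_is_group cstar_algebra_axioms partial]
  have mem: "(a, w) \<in> carrier affine_group" if "w \<noteq> 0" for a w :: "'r fract"
    using that by (simp add: affine_group_def)
  have c': "to_fract c \<noteq> 0" and m': "to_fract m \<noteq> 0" using c m by simp_all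
  have "star P (\<pi> (0, to_fract c)) = \<pi> (0, 1 / to_fract c)"
    using rep_inv[of "(0, to_fract c)"] mem c' by (simp add: affine_group_inv)
  moreover have "\<pi> (0, 1 / to_fract c) \<otimes>\<^bsub>P\<^esub> \<pi> (to_fract n, 1) =
      \<pi> (to_fract n / to_fract c, 1 / to_fract c)"
    using mult[of "(0, 1 / to_fract c)" "(to_fract n, 1)"] translation_unit[of "- n"] mem c'
    by (simp add: affine_group_inv) (simp add: affine_group_def)
  moreover have "\<pi> (to_fract n / to_fract c, 1 / to_fract c) \<otimes>\<^bsub>P\<^esub> \<pi> (0, to_fract m) =
      \<pi> (to_fract n / to_fract c, to_fract m / to_fract c)"
    using mult[of "(to_fract n / to_fract c, 1 / to_fract c)" "(0, to_fract m)"]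
      division_unit[OF m] mem c' m'
    by (simp add: affine_group_inv) (simp add: affine_group_def)
  ultimately show ?thesis by simp
qed

end

section \<open>The two expectations agree\<close>

lemma cstar_generated_mono: "S \<subseteq> T \<Longrightarrow> cstar_generated A S \<subseteq> cstar_generated A T"
  by (auto simp: cstar_generated_def)

lemma cuntz_li_relationsD:
  assumes "cuntz_li_relations A s u"
  shows "u n \<in> carrier A"
    and "star A (u n) \<otimes>\<^bsub>A\<^esub> u n = \<one>\<^bsub>A\<^esub>"
    and "u n \<otimes>\<^bsub>A\<^esub> u n' = u (n + n')"
    and "m \<noteq> 0 \<Longrightarrow> s m \<in> carrier A"
    and "m \<noteq> 0 \<Longrightarrow> star A (s m) \<otimes>\<^bsub>A\<^esub> s m = \<one>\<^bsub>A\<^esub>"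
    and "\<lbrakk>m \<noteq> 0; m' \<noteq> 0\<rbrakk> \<Longrightarrow> s m \<otimes>\<^bsub>A\<^esub> s m' = s (m * m')"
proof -
  from assms have
    "\<forall>m. m \<noteq> 0 \<longrightarrow> s m \<in> carrier A \<and> star A (s m) \<otimes>\<^bsub>A\<^esub> s m = \<one>\<^bsub>A\<^esub>"
    "\<forall>n. u n \<in> carrier A \<and> star A (u n) \<otimes>\<^bsub>A\<^esub> u n = \<one>\<^bsub>A\<^esub> \<and> u n \<otimes>\<^bsub>A\<^esub> star A (u n) = \<one>\<^bsub>A\<^esub>"
    "\<forall>m m'. m \<noteq> 0 \<longrightarrow> m' \<noteq> 0 \<longrightarrow> s m \<otimes>\<^bsub>A\<^esub> s m' = s (m * m')"
    "\<forall>n n'. u n \<otimes>\<^bsub>A\<^esub> u n' = u (n + n')"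
    unfolding cuntz_li_relations_def by - (elim conjE, assumption)+
  then show "u n \<in> carrier A" "star A (u n) \<otimes>\<^bsub>A\<^esub> u n = \<one>\<^bsub>A\<^esub>"
    "u n \<otimes>\<^bsub>A\<^esub> u n' = u (n + n')"
    "m \<noteq> 0 \<Longrightarrow> s m \<in> carrier A"
    "m \<noteq> 0 \<Longrightarrow> star A (s m) \<otimes>\<^bsub>A\<^esub> s m = \<one>\<^bsub>A\<^esub>"
    "\<lbrakk>m \<noteq> 0; m' \<noteq> 0\<rbrakk> \<Longrightarrow> s m \<otimes>\<^bsub>A\<^esub> s m' = s (m * m')"
    by simp_all
qed

lemma cuntz_li_units:
  assumes A: "cstar_algebra A" and rel: "cuntz_li_relations A s u"
  shows "u 0 = \<one>\<^bsub>A\<^esub>" and "s 1 = \<one>\<^bsub>A\<^esub>"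
proof -
  interpret A: cstar_algebra A by (rule A)
  note [simp] = cuntz_li_relationsD[OF rel]
  show "u 0 = \<one>\<^bsub>A\<^esub>" "s 1 = \<one>\<^bsub>A\<^esub>"
    by (rule A.isometric_idempotent_eq_one; simp)+
qed

lemma cuntz_li_star_u:
  assumes A: "cstar_algebra A" and rel: "cuntz_li_relations A s u"
  shows "star A (u n) = u (- n)"
proof -
  interpret A: cstar_algebra A by (rule A)
  note u = cuntz_li_relationsD(1-3)[OF rel]
  have "star A (u n) = star A (u n) \<otimes>\<^bsub>A\<^esub> (u n \<otimes>\<^bsub>A\<^esub> u (- n))"
    using u(1) by (simp add: u(3) cuntz_li_units[OF A rel])
  also have "\<dots> = u (- n)"
    using u(1) by (simp add: u(2) flip: A.m_assoc)
  finally show ?thesis .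
qed

lemma conditional_expectationD:
  assumes "conditional_expectation A D F"
  shows "cstar_subalgebra A D"
    and "x \<in> carrier A \<Longrightarrow> F x \<in> D"
    and "\<lbrakk>x \<in> carrier A; y \<in> carrier A\<rbrakk> \<Longrightarrow> F (x \<oplus>\<^bsub>A\<^esub> y) = F x \<oplus>\<^bsub>A\<^esub> F y"
    and "x \<in> carrier A \<Longrightarrow> F (c \<odot>\<^bsub>A\<^esub> x) = c \<odot>\<^bsub>A\<^esub> F x"
    and "\<lbrakk>x \<in> carrier A; d \<in> D\<rbrakk> \<Longrightarrow> F (x \<otimes>\<^bsub>A\<^esub> d) = F x \<otimes>\<^bsub>A\<^esub> d"
    and "x \<in> carrier A \<Longrightarrow> cnorm A (F x) \<le> cnorm A x"
    and "x \<in> carrier A \<Longrightarrow> F x \<in> carrier A"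
proof -
  from assms have *: "cstar_subalgebra A D" "F \<in> carrier A \<rightarrow> D"
    "\<forall>x\<in>carrier A. \<forall>y\<in>carrier A. F (x \<oplus>\<^bsub>A\<^esub> y) = F x \<oplus>\<^bsub>A\<^esub> F y"
    "\<forall>c. \<forall>x\<in>carrier A. F (c \<odot>\<^bsub>A\<^esub> x) = c \<odot>\<^bsub>A\<^esub> F x"
    "\<forall>d\<in>D. \<forall>x\<in>carrier A. F (d \<otimes>\<^bsub>A\<^esub> x) = d \<otimes>\<^bsub>A\<^esub> F x \<and> F (x \<otimes>\<^bsub>A\<^esub> d) = F x \<otimes>\<^bsub>A\<^esub> d"
    "\<forall>x\<in>carrier A. cnorm A (F x) \<le> cnorm A x"
    unfolding conditional_expectation_def by - (elim conjE, assumption)+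
  moreover have "D \<subseteq> carrier A" using *(1) by (simp add: cstar_subalgebra_def)
  ultimately show "cstar_subalgebra A D" "x \<in> carrier A \<Longrightarrow> F x \<in> D"
    "\<lbrakk>x \<in> carrier A; y \<in> carrier A\<rbrakk> \<Longrightarrow> F (x \<oplus>\<^bsub>A\<^esub> y) = F x \<oplus>\<^bsub>A\<^esub> F y"
    "x \<in> carrier A \<Longrightarrow> F (c \<odot>\<^bsub>A\<^esub> x) = c \<odot>\<^bsub>A\<^esub> F x"
    "\<lbrakk>x \<in> carrier A; d \<in> D\<rbrakk> \<Longrightarrow> F (x \<otimes>\<^bsub>A\<^esub> d) = F x \<otimes>\<^bsub>A\<^esub> d"
    "x \<in> carrier A \<Longrightarrow> cnorm A (F x) \<le> cnorm A x"
    "x \<in> carrier A \<Longrightarrow> F x \<in> carrier A"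
    by (simp_all add: Pi_iff subset_iff)
qed

theorem proposition4p1:
  fixes A :: "'a cstar" and s u :: "'r::idom \<Rightarrow> 'a"
    and P :: "'b cstar" and \<pi> :: "'r fract \<times> 'r fract \<Rightarrow> 'b"
    and \<Psi> :: "'a \<Rightarrow> 'b" and E :: "'b \<Rightarrow> 'b" and \<Theta> :: "'a \<Rightarrow> 'a" and D :: "'a set"
  assumes finite_quotients: "\<And>m::'r. m \<noteq> 0 \<Longrightarrow> finite (principal_cosets m)"
    and A: "is_ring_cstar_algebra A s u"
    and P: "is_partial_group_cstar_algebra affine_group
              (relations1 \<union> relations2 \<union> relations3) P \<pi>"
    and \<Psi>: "\<Psi> \<in> cstar_iso A P"
    and \<Psi>_u: "\<And>n. \<Psi> (u n) = \<pi> (to_fract n, 1)"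
    and \<Psi>_s: "\<And>m. m \<noteq> 0 \<Longrightarrow> \<Psi> (s m) = \<pi> (0, to_fract m)"
    and E: "faithful_conditional_expectation P
              (cstar_generated P (range_proj affine_group P \<pi> ` carrier affine_group)) E"
    and E_formula: "\<And>gs. set gs \<subseteq> carrier affine_group \<Longrightarrow>
          E (list_prod P (map \<pi> gs)) =
            (if list_prod affine_group gs = \<one>\<^bsub>affine_group\<^esub>
             then list_prod P (map \<pi> gs) else \<zero>\<^bsub>P\<^esub>)"
    and \<Theta>: "faithful_conditional_expectation A D \<Theta>"
    and \<Theta>_formula: "\<And>m m' m'' n n'. m \<noteq> 0 \<Longrightarrow> m' \<noteq> 0 \<Longrightarrow> m'' \<noteq> 0 \<Longrightarrow>
          \<Theta> (star A (s m'') \<otimes>\<^bsub>A\<^esub> u n \<otimes>\<^bsub>A\<^esub> s m \<otimes>\<^bsub>A\<^esub> star A (s m) \<otimes>\<^bsub>A\<^esub> u (- n') \<otimes>\<^bsub>A\<^esub> s m') =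
            (if m' = m'' \<and> n = n'
             then star A (s m') \<otimes>\<^bsub>A\<^esub> u n \<otimes>\<^bsub>A\<^esub> s m \<otimes>\<^bsub>A\<^esub> star A (s m) \<otimes>\<^bsub>A\<^esub> u (- n) \<otimes>\<^bsub>A\<^esub> s m'
             else \<zero>\<^bsub>A\<^esub>)"
  shows "\<forall>x\<in>carrier A. E (\<Psi> x) = \<Psi> (\<Theta> x)"
proof
  fix x assume x: "x \<in> carrier A"
  let ?G = "affine_group :: ('r fract \<times> 'r fract) monoid"
  let ?e = "range_proj ?G P \<pi>"
  have G: "group ?G" by (rule affine_group_is_group)
  have algA: "cstar_algebra A" and clr: "cuntz_li_relations A s u"
    and gen: "cstar_generated A (s ` (UNIV - {0}) \<union> range u) = carrier A"
    using A by (auto simp: is_ring_cstar_algebra_def)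
  have algP: "cstar_algebra P"
    and relP: "partial_relations_with ?G (relations1 \<union> relations2 \<union> relations3) P \<pi>"
    using P by (auto simp: is_partial_group_cstar_algebra_def)
  interpret G: group ?G by (rule G)
  interpret A: cstar_algebra A by (rule algA)
  interpret P: affine_partial_representation P \<pi>
    using algP relP by (intro affine_partial_representation.intro
        affine_partial_representation_axioms.intro)
  have hom: "\<Psi> \<in> cstar_hom A P" and bij: "bij_betw \<Psi> (carrier A) (carrier P)"
    using \<Psi> by (auto simp: cstar_iso_def)
  note \<Psi>_hom = cstar_homD[OF hom]
  have ce_E: "conditional_expectation P (cstar_generated P (?e ` carrier ?G)) E"
    and ce_\<Theta>: "conditional_expectation A D \<Theta>"
    using E \<Theta> by (auto simp: faithful_conditional_expectation_def)
  note E_D = conditional_expectationD[OF ce_E]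
    and \<Theta>_D = conditional_expectationD[OF ce_\<Theta>]
  have D_sub: "D \<subseteq> carrier A" and D_mult: "\<lbrakk>y \<in> D; z \<in> D\<rbrakk> \<Longrightarrow> y \<otimes>\<^bsub>A\<^esub> z \<in> D" for y z
    using \<Theta>_D(1) by (auto simp: cstar_subalgebra_def)

  note u = cuntz_li_relationsD(1)[OF clr]
    and s = cuntz_li_relationsD(4)[OF clr]
    and units = cuntz_li_units[OF algA clr]
  have star_u: "star A (u n) = u (- n)" for n by (rule cuntz_li_star_u[OF algA clr])

  define a where "a c n m = star A (s c) \<otimes>\<^bsub>A\<^esub> u n \<otimes>\<^bsub>A\<^esub> s m" for c n m
  have a_closed: "a c n m \<in> carrier A" if "c \<noteq> 0" "m \<noteq> 0" for c n m
    using that s u by (simp add: a_def)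
  have \<Psi>_a: "\<Psi> (a c n m) = \<pi> (to_fract n / to_fract c, to_fract m / to_fract c)"
    if "c \<noteq> 0" "m \<noteq> 0" for c n m
    using that s u by (simp add: a_def \<Psi>_hom \<Psi>_u \<Psi>_s P.factorization)
  \<comment> \<open>The element \<open>s c\<^sup>* u n s m\<close> has the shape in the formula for \<open>\<Theta>\<close>, with \<open>s 1 s 1\<^sup>* u 0 = 1\<close>
    inserted before the last factor.\<close>
  have \<Theta>_a: "\<Theta> (a c n m) = (if m = c \<and> n = 0 then a c n m else \<zero>\<^bsub>A\<^esub>)"
    if "c \<noteq> 0" "m \<noteq> 0" for c n m
    using \<Theta>_formula[of 1 m c n 0] that s u by (simp add: a_def units)
  have proj_D: "?e g \<in> \<Psi> ` D" if g: "g \<in> carrier ?G" for g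
  proof -
    obtain n m c where nmc: "m \<noteq> 0" "c \<noteq> 0"
      and g_eq: "g = (to_fract n / to_fract c, to_fract m / to_fract c)"
      using affine_group_elem_cases[OF g] by metis
    define d where "d = a c n m \<otimes>\<^bsub>A\<^esub> star A (a c n m)"
    have d_closed: "d \<in> carrier A" using nmc a_closed by (simp add: d_def)
    have d_eq: "d = star A (s c) \<otimes>\<^bsub>A\<^esub> u n \<otimes>\<^bsub>A\<^esub> s m \<otimes>\<^bsub>A\<^esub> star A (s m) \<otimes>\<^bsub>A\<^esub> u (- n) \<otimes>\<^bsub>A\<^esub> s c"
      using nmc s u by (simp add: d_def a_def A.star_mult A.star_star star_u A.m_assoc)
    have "\<Theta> d = d" unfolding d_eq using \<Theta>_formula[of m c c n n] nmc by simp
    then have "d \<in> D" using \<Theta>_D(2)[OF d_closed] by simp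
    moreover have "\<Psi> d = ?e g"
      using nmc a_closed g by (simp add: d_def \<Psi>_hom \<Psi>_a range_proj_def P.rep_inv flip: g_eq)
    ultimately show ?thesis by (metis imageI)
  qed
  have projs_D: "list_prod P (map ?e hs) \<in> \<Psi> ` D" if "set hs \<subseteq> carrier ?G" for hs
    using that
  proof (induction hs)
    case Nil
    have "?e \<one>\<^bsub>?G\<^esub> = \<one>\<^bsub>P\<^esub>"
      using P.partial by (simp add: range_proj_def partial_relations_def)
    then show ?case using proj_D[of "\<one>\<^bsub>?G\<^esub>"] by (simp add: list_prod_def)
  next
    case (Cons h hs)
    then obtain d d' where "d \<in> D" "?e h = \<Psi> d" "d' \<in> D" "list_prod P (map ?e hs) = \<Psi> d'"
      using proj_D[of h] by auto
    then have "list_prod P (map ?e (h # hs)) = \<Psi> (d \<otimes>\<^bsub>A\<^esub> d')" "d \<otimes>\<^bsub>A\<^esub> d' \<in> D"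
      using D_sub D_mult by (auto simp: list_prod_def \<Psi>_hom subset_iff)
    then show ?case by blast
  qed

  define S where "S = s ` (UNIV - {0}) \<union> range u"
  define T where "T = S \<union> star A ` S"
  have S_closed: "S \<subseteq> carrier A" using s u by (auto simp: S_def)
  have T_closed: "T \<subseteq> carrier A" and T_star: "star A ` T \<subseteq> T"
    using S_closed by (auto simp: T_def subset_iff A.star_star)
  have \<Psi>_S: "\<exists>g\<in>carrier ?G. \<Psi> y = \<pi> g" if y: "y \<in> S" for y
  proof -
    have G_mem: "(to_fract n, 1) \<in> carrier ?G" "m \<noteq> 0 \<Longrightarrow> (0, to_fract m) \<in> carrier ?G" for n m :: 'r
      by (simp_all add: affine_group_def)
    consider m where "m \<noteq> 0" "y = s m" | n where "y = u n"
      using y unfolding S_def by auto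
    then show ?thesis
    proof cases
      case (1 m)
      then show ?thesis using G_mem(2) \<Psi>_s by blast
    next
      case (2 n)
      then show ?thesis using G_mem(1) \<Psi>_u by blast
    qed
  qed
  have \<Psi>_T: "\<exists>g\<in>carrier ?G. \<Psi> y = \<pi> g" if y: "y \<in> T" for y
  proof (cases "y \<in> S")
    case False
    then obtain z where z: "z \<in> S" "y = star A z" using y by (auto simp: T_def)
    then obtain g where "g \<in> carrier ?G" "\<Psi> z = \<pi> g" using \<Psi>_S by blast
    then show ?thesis
      using z S_closed by (intro bexI[of _ "inv\<^bsub>?G\<^esub> g"]) (auto simp: \<Psi>_hom P.rep_inv subset_iff)
  qed (rule \<Psi>_S)
  have \<Psi>_word: "\<exists>gs. set gs \<subseteq> carrier ?G \<and> \<Psi> (list_prod A ys) = list_prod P (map \<pi> gs)"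
    if "set ys \<subseteq> T" for ys
    using that
  proof (induction ys)
    case Nil
    then show ?case by (intro exI[of _ "[]"]) (simp add: list_prod_def \<Psi>_hom)
  next
    case (Cons y ys)
    then obtain gs where gs: "set gs \<subseteq> carrier ?G" "\<Psi> (list_prod A ys) = list_prod P (map \<pi> gs)"
      by auto
    obtain g where g: "g \<in> carrier ?G" "\<Psi> y = \<pi> g" using \<Psi>_T[of y] Cons.prems by auto
    have "y \<in> carrier A" "list_prod A ys \<in> carrier A"
      using Cons.prems T_closed by (auto intro!: A.list_prod_closed)
    then have "\<Psi> (list_prod A (y # ys)) = list_prod P (map \<pi> (g # gs))"
      using gs g by (simp add: list_prod_def \<Psi>_hom)
    then show ?case using gs(1) g(1) by (intro exI[of _ "g # gs"]) simp
  qed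
  have words: "E (\<Psi> (list_prod A ys)) = \<Psi> (\<Theta> (list_prod A ys))" if ys: "set ys \<subseteq> T" for ys
  proof -
    define w where "w = list_prod A ys"
    have w: "w \<in> carrier A" using ys T_closed by (auto simp: w_def intro!: A.list_prod_closed)
    obtain gs where gs: "set gs \<subseteq> carrier ?G" "\<Psi> w = list_prod P (map \<pi> gs)"
      using \<Psi>_word[OF ys] by (auto simp: w_def)
    define g where "g = list_prod ?G gs"
    have g: "g \<in> carrier ?G" using list_prod_in_group[OF G gs(1)] by (simp add: g_def)
    obtain hs where "set hs \<subseteq> carrier ?G" "\<Psi> w = \<pi> g \<otimes>\<^bsub>P\<^esub> list_prod P (map ?e hs)"
      using partial_word[OF G algP P.partial gs(1)] gs(2) by (auto simp: g_def)
    then obtain d where d: "d \<in> D" "\<Psi> w = \<pi> g \<otimes>\<^bsub>P\<^esub> \<Psi> d" using projs_D[of hs] by auto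
    have d_closed: "d \<in> carrier A" using d(1) D_sub by blast
    obtain n m c where nmc: "m \<noteq> 0" "c \<noteq> 0"
      and g_eq: "g = (to_fract n / to_fract c, to_fract m / to_fract c)"
      using affine_group_elem_cases[OF g] by metis
    have "\<Psi> w = \<Psi> (a c n m \<otimes>\<^bsub>A\<^esub> d)"
      using d nmc a_closed d_closed by (simp add: \<Psi>_hom \<Psi>_a flip: g_eq)
    then have w_eq: "w = a c n m \<otimes>\<^bsub>A\<^esub> d"
      using bij w nmc a_closed d_closed unfolding bij_betw_def by (metis A.m_closed inj_onD)
    \<comment> \<open>The representation of \<open>g\<close> as a pair of fractions is not unique, but whether \<open>g\<close> is the
      identity can be read off from any of them.\<close>
    have g_one: "g = \<one>\<^bsub>?G\<^esub> \<longleftrightarrow> m = c \<and> n = 0"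
      using nmc by (auto simp: g_eq affine_group_def)
    have "\<Theta> w = \<Theta> (a c n m) \<otimes>\<^bsub>A\<^esub> d"
      unfolding w_eq using \<Theta>_D(5) a_closed nmc d(1) by simp
    also have "\<dots> = (if g = \<one>\<^bsub>?G\<^esub> then w else \<zero>\<^bsub>A\<^esub>)"
      using nmc d_closed by (simp add: \<Theta>_a g_one w_eq)
    finally have "\<Psi> (\<Theta> w) = (if g = \<one>\<^bsub>?G\<^esub> then \<Psi> w else \<Psi> \<zero>\<^bsub>A\<^esub>)" by simp
    moreover have "\<Psi> \<zero>\<^bsub>A\<^esub> = \<zero>\<^bsub>P\<^esub>"
      using \<Psi>_hom(5)[of "\<zero>\<^bsub>A\<^esub>" 0] \<Psi>_hom(1)[of "\<zero>\<^bsub>A\<^esub>"] by simp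
    ultimately show ?thesis
      using E_formula[OF gs(1)] gs(2) by (simp add: g_def w_def)
  qed

  have \<Psi>_norm: "cnorm P (\<Psi> y) \<le> cnorm A y" if "y \<in> carrier A" for y
    by (rule cstar_hom_contractive[OF algA algP hom that])
  have E\<Psi>: "bounded_semilinear A P id (\<lambda>y. E (\<Psi> y))"
    unfolding bounded_semilinear_def
  proof (intro conjI ballI allI exI)
    show "cnorm P (E (\<Psi> y)) \<le> 1 * cnorm A y" if "y \<in> carrier A" for y
      using order_trans[OF E_D(6) \<Psi>_norm] \<Psi>_hom(1) that by simp
  qed (simp_all add: \<Psi>_hom E_D)
  have \<Psi>\<Theta>: "bounded_semilinear A P id (\<lambda>y. \<Psi> (\<Theta> y))"
    unfolding bounded_semilinear_def
  proof (intro conjI ballI allI exI)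
    show "cnorm P (\<Psi> (\<Theta> y)) \<le> 1 * cnorm A y" if "y \<in> carrier A" for y
      using order_trans[OF \<Psi>_norm \<Theta>_D(6)] \<Theta>_D(7) that by simp
  qed (simp_all add: \<Psi>_hom \<Theta>_D)
  show "E (\<Psi> x) = \<Psi> (\<Theta> x)"
  proof (rule bounded_maps_eq_on_generated[OF algA algP E\<Psi> \<Psi>\<Theta> T_closed T_star])
    show "x \<in> cstar_generated A T"
      using x gen cstar_generated_mono[of S T A] by (auto simp: S_def T_def)
  qed (rule words)
qed

end
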